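(* Let $\mathbb{K}$ be an algebraically closed field of characteristic $0$ and let $r\ge2$. Let $\mathcal{D}\subseteq\mathbb{P}(\mathbb{K}^{r\times r})$ be the Zariski closure of the set $\{[A]\in\mathbb{P}(\mathbb{K}^{r\times r}) : A \text{ is non-diagonalizable}\}$. Then $\mathcal{D}$ is a hypersurface of degree $2\,c_{r-2}(T_{\mathbb{P}^{r-1}})$.
   Context: $T_{\mathbb{P}^{r-1}}$ is the tangent bundle of $\mathbb{P}^{r-1}$, and $c_{r-2}(T_{\mathbb{P}^{r-1}})$ denotes its $(r-2)$-nd Chern class, identified with an integer as the coefficient of the $(r-2)$-nd power of the hyperplane class. *)

theory Defs
  imports
    "HOL-Library.Poly_Mapping"
    "HOL-Computational_Algebra.Polynomial"
    "Jordan_Normal_Form.Matrix"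
begin

section \<open>Projective geometry of the space of matrices\<close>

text \<open>
  The polynomial ring in the matrix entries \<open>x\<^sub>i\<^sub>j\<close> is realised as finitely supported functions
  on monomials, a monomial being a finitely supported function from index pairs to exponents;
  \<open>mat_polys r\<close> is the subring in which only the variables with \<open>i, j < r\<close> occur.
\<close>

type_synonym 'a mat_poly = "((nat \<times> nat) \<Rightarrow>\<^sub>0 nat) \<Rightarrow>\<^sub>0 'a"

definition mat_polys :: "nat \<Rightarrow> 'a::comm_ring_1 mat_poly set" where
  "mat_polys r = {F. \<forall>m\<in>Poly_Mapping.keys F. Poly_Mapping.keys m \<subseteq> {..<r} \<times> {..<r}}"

definition eval_mat_poly :: "'a::comm_ring_1 mat_poly \<Rightarrow> 'a mat \<Rightarrow> 'a" where
  "eval_mat_poly F A =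
     (\<Sum>m\<in>Poly_Mapping.keys F. Poly_Mapping.lookup F m *
        (\<Prod>v\<in>Poly_Mapping.keys m. (A $$ v) ^ Poly_Mapping.lookup m v))"

definition homogeneous :: "nat \<Rightarrow> 'a::comm_ring_1 mat_poly \<Rightarrow> bool" where
  "homogeneous d F \<longleftrightarrow>
     (\<forall>m\<in>Poly_Mapping.keys F. (\<Sum>v\<in>Poly_Mapping.keys m. Poly_Mapping.lookup m v) = d)"

definition forms :: "nat \<Rightarrow> 'a::comm_ring_1 mat_poly set" where
  "forms r = {F \<in> mat_polys r. \<exists>d. homogeneous d F}"

text \<open>
  A point of the projective space of \<open>r \<times> r\<close> matrices is the set of all representatives
  of its homogeneous coordinates.
\<close>

definition nonzero_mats :: "nat \<Rightarrow> 'a::field mat set" where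
  "nonzero_mats r = carrier_mat r r - {0\<^sub>m r r}"

definition proj_point :: "'a::field mat \<Rightarrow> 'a mat set" where
  "proj_point A = {c \<cdot>\<^sub>m A | c. c \<noteq> 0}"

definition zero_locus :: "nat \<Rightarrow> 'a::field mat_poly set \<Rightarrow> 'a mat set set" where
  "zero_locus r S = {proj_point A | A. A \<in> nonzero_mats r \<and> (\<forall>F\<in>S. eval_mat_poly F A = 0)}"

definition zariski_closed :: "nat \<Rightarrow> 'a::field mat set set \<Rightarrow> bool" where
  "zariski_closed r Z \<longleftrightarrow> (\<exists>S. S \<subseteq> forms r \<and> Z = zero_locus r S)"

definition zariski_closure :: "nat \<Rightarrow> 'a::field mat set set \<Rightarrow> 'a mat set set" where
  "zariski_closure r X = \<Inter>{Z. zariski_closed r Z \<and> X \<subseteq> Z}"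

definition vanishing_ideal :: "nat \<Rightarrow> 'a::field mat set set \<Rightarrow> 'a mat_poly set" where
  "vanishing_ideal r Z =
     {G \<in> mat_polys r. \<forall>A \<in> nonzero_mats r. proj_point A \<in> Z \<longrightarrow> eval_mat_poly G A = 0}"

text \<open>
  The degree of a hypersurface is that of its reduced equation, i.e. of a form that
  generates the whole vanishing ideal (not merely of some form cutting it out).
\<close>

definition hypersurface_of_degree :: "nat \<Rightarrow> 'a::field mat set set \<Rightarrow> nat \<Rightarrow> bool" where
  "hypersurface_of_degree r Z d \<longleftrightarrow>
     d > 0 \<and> (\<exists>F \<in> mat_polys r. F \<noteq> 0 \<and> homogeneous d F \<and> Z = zero_locus r {F} \<and>
                vanishing_ideal r Z = {F * G | G. G \<in> mat_polys r})"

definition diagonalizable_mat :: "'a::field mat \<Rightarrow> bool" where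
  "diagonalizable_mat A \<longleftrightarrow> (\<exists>D. diagonal_mat D \<and> similar_mat A D)"

definition nondiag_closure :: "nat \<Rightarrow> 'a::field mat set set" where
  "nondiag_closure r =
     zariski_closure r {proj_point A | A. A \<in> nonzero_mats r \<and> \<not> diagonalizable_mat A}"


section \<open>Vector bundles on projective space\<close>

text \<open>
  Regular functions on open subsets of \<open>n\<close>-dimensional projective space are represented as
  Laurent polynomials in the homogeneous coordinates \<open>x\<^sub>0, \<dots>, x\<^sub>n\<close>. For a set \<open>S\<close> of
  indices, \<open>regular_on n S\<close> is the ring of regular functions on the locus where all \<open>x\<^sub>l\<close>
  with \<open>l \<in> S\<close> are nonzero: degree zero, and only those \<open>x\<^sub>l\<close> may have negative exponents.
\<close>

type_synonym 'a laurent = "(nat \<Rightarrow>\<^sub>0 int) \<Rightarrow>\<^sub>0 'a"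

definition hcoord_pow :: "nat \<Rightarrow> int \<Rightarrow> 'a::comm_ring_1 laurent" where
  "hcoord_pow k e = Poly_Mapping.single (Poly_Mapping.single k e) 1"

definition regular_on :: "nat \<Rightarrow> nat set \<Rightarrow> 'a::comm_ring_1 laurent set" where
  "regular_on n S =
     {f. \<forall>m\<in>Poly_Mapping.keys f.
           Poly_Mapping.keys m \<subseteq> {..n} \<and>
           (\<Sum>l\<le>n. Poly_Mapping.lookup m l) = 0 \<and>
           (\<forall>l. l \<notin> S \<longrightarrow> Poly_Mapping.lookup m l \<ge> 0)}"

definition regular_mats :: "nat \<Rightarrow> nat \<Rightarrow> nat set \<Rightarrow> 'a::comm_ring_1 laurent mat set" where
  "regular_mats n m S = {M \<in> carrier_mat m m. elements_mat M \<subseteq> regular_on n S}"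

text \<open>
  A bundle of rank \<open>m\<close> is given by transition matrices over the standard charts
  \<open>U\<^sub>i = {x\<^sub>i \<noteq> 0}\<close>, with the convention \<open>s\<^sub>i = g\<^sub>i\<^sub>j s\<^sub>j\<close> for the coordinate vectors of a
  section. Every vector bundle arises in this way, because vector bundles on the affine
  spaces \<open>U\<^sub>i\<close> are trivial (Quillen--Suslin). Values at indices greater than \<open>n\<close> are irrelevant.
\<close>

type_synonym 'a cocycle = "nat \<Rightarrow> nat \<Rightarrow> 'a laurent mat"

definition vector_bundle :: "nat \<Rightarrow> nat \<Rightarrow> 'a::comm_ring_1 cocycle \<Rightarrow> bool" where
  "vector_bundle n m g \<longleftrightarrow>
     (\<forall>i\<le>n. \<forall>j\<le>n. g i j \<in> regular_mats n m {i, j}) \<and>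
     (\<forall>i\<le>n. g i i = 1\<^sub>m m) \<and>
     (\<forall>i\<le>n. \<forall>j\<le>n. \<forall>k\<le>n. g i j * g j k = g i k)"

definition bundle_iso :: "nat \<Rightarrow> nat \<Rightarrow> 'a::comm_ring_1 cocycle \<Rightarrow> 'a cocycle \<Rightarrow> bool" where
  "bundle_iso n m g h \<longleftrightarrow>
     (\<exists>a b. (\<forall>i\<le>n. a i \<in> regular_mats n m {i} \<and> b i \<in> regular_mats n m {i} \<and>
                    a i * b i = 1\<^sub>m m \<and> b i * a i = 1\<^sub>m m) \<and>
            (\<forall>i\<le>n. \<forall>j\<le>n. h i j * a j = a i * g i j))"

text \<open>
  An extension \<open>0 \<rightarrow> E \<rightarrow> F \<rightarrow> G \<rightarrow> 0\<close> splits over each affine \<open>U\<^sub>i\<close>, so in adapted frames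
  \<open>F\<close> has block upper triangular transition matrices; up to isomorphism, this describes all
  short exact sequences of bundles.
\<close>

definition bundle_extension ::
  "nat \<Rightarrow> nat \<Rightarrow> nat \<Rightarrow> 'a::comm_ring_1 cocycle \<Rightarrow> 'a cocycle \<Rightarrow> 'a cocycle \<Rightarrow> bool" where
  "bundle_extension n p q E F G \<longleftrightarrow>
     vector_bundle n p E \<and> vector_bundle n (p + q) F \<and> vector_bundle n q G \<and>
     (\<forall>i\<le>n. \<forall>j\<le>n. \<exists>B \<in> carrier_mat p q. F i j = four_block_mat (E i j) B (0\<^sub>m q p) (G i j))"

text \<open>
  The line bundle \<open>O(d)\<close> has transition functions \<open>(x\<^sub>j / x\<^sub>i)\<^sup>d\<close>: a form \<open>s\<close> of degree \<open>d\<close>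
  has local coordinate \<open>s / x\<^sub>i\<^sup>d\<close> on \<open>U\<^sub>i\<close>.
\<close>

definition twisting_bundle :: "int \<Rightarrow> 'a::comm_ring_1 cocycle" where
  "twisting_bundle d i j = mat 1 1 (\<lambda>_. hcoord_pow j d * hcoord_pow i (- d))"

text \<open>
  The tangent bundle is given by the Jacobian matrices of the changes of affine coordinates.
  The coordinates on \<open>U\<^sub>i\<close> are \<open>x\<^sub>k / x\<^sub>i\<close> with \<open>k \<noteq> i\<close>; the \<open>a\<close>-th of them has
  \<open>k = chart_index i a\<close>. For \<open>f\<close> homogeneous of degree zero, the derivative of \<open>f\<close> with
  respect to the coordinate \<open>x\<^sub>l / x\<^sub>j\<close> of the chart \<open>U\<^sub>j\<close> is \<open>x\<^sub>j\<close> times the formal partial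
  derivative of \<open>f\<close> with respect to \<open>x\<^sub>l\<close>.
\<close>

definition laurent_deriv :: "nat \<Rightarrow> 'a::comm_ring_1 laurent \<Rightarrow> 'a laurent" where
  "laurent_deriv l f =
     (\<Sum>m\<in>Poly_Mapping.keys f.
        Poly_Mapping.single (m - Poly_Mapping.single l 1)
          (of_int (Poly_Mapping.lookup m l) * Poly_Mapping.lookup f m))"

definition chart_index :: "nat \<Rightarrow> nat \<Rightarrow> nat" where
  "chart_index i a = (if a < i then a else Suc a)"

definition affine_coord :: "nat \<Rightarrow> nat \<Rightarrow> 'a::comm_ring_1 laurent" where
  "affine_coord i a = hcoord_pow (chart_index i a) 1 * hcoord_pow i (- 1)"

definition tangent_bundle :: "nat \<Rightarrow> 'a::comm_ring_1 cocycle" where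
  "tangent_bundle n i j =
     mat n n (\<lambda>(a, b). hcoord_pow j 1 * laurent_deriv (chart_index j b) (affine_coord i a))"


section \<open>Chern classes\<close>

text \<open>
  The Chow ring of \<open>n\<close>-dimensional projective space is \<open>\<int>[h] / (h\<^sup>n\<^sup>+\<^sup>1)\<close> with \<open>h\<close> the
  hyperplane class, so the \<open>k\<close>-th Chern class of \<open>E\<close> is recorded by the integer \<open>c E k\<close> with
  \<open>c\<^sub>k(E) = (c E k) h\<^sup>k\<close>. The following axioms (invariance under isomorphism, Whitney sum
  formula, and \<open>c(O(d)) = 1 + d h\<close>) determine Chern classes uniquely, since every vector bundle
  on projective space has the same class in K-theory as a combination of line bundles \<open>O(d)\<close>.
\<close>

definition chern_classes :: "nat \<Rightarrow> ('a::field cocycle \<Rightarrow> nat \<Rightarrow> int) \<Rightarrow> bool" where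
  "chern_classes n c \<longleftrightarrow>
     (\<forall>m E. vector_bundle n m E \<longrightarrow> c E 0 = 1) \<and>
     (\<forall>m E F. vector_bundle n m E \<and> vector_bundle n m F \<and> bundle_iso n m E F \<longrightarrow>
        (\<forall>k\<le>n. c E k = c F k)) \<and>
     (\<forall>p q E F G. bundle_extension n p q E F G \<longrightarrow>
        (\<forall>k\<le>n. c F k = (\<Sum>i\<le>k. c E i * c G (k - i)))) \<and>
     (\<forall>d. \<forall>k\<le>n. c (twisting_bundle d) k = (if k = 0 then 1 else if k = 1 then d else 0))"

end

theory Submission
  imports
    Defs
    "Jordan_Normal_Form.Jordan_Normal_Form_Existence"
    "HOL-Number_Theory.Cong"
begin

text \<open>
  Let \<open>F\<close> be the discriminant of the characteristic polynomial of the generic matrix, a form of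
  degree \<open>N = r (r - 1)\<close>. It vanishes at every non-diagonalizable matrix, and if \<open>F\<close> vanishes at a
  diagonalizable \<open>A\<close> then \<open>t\<^sup>2\<close> divides \<open>F (A + t M)\<close> for all \<open>M\<close>, because modulo
  \<open>t\<^sup>2\<close> the eigenvalues of \<open>A + t M\<close> are polynomials in \<open>t\<close>, two of which agree at
  \<open>t = 0\<close>. So simple roots \<open>t\<close> of \<open>F (A + t M)\<close> give non-diagonalizable matrices \<open>A + t M\<close>. Let \<open>G\<close> vanish on the non-diagonalizable matrices, fix \<open>M\<close>
  with \<open>F M \<noteq> 0\<close>, and divide \<open>G (X + t M)\<close> by \<open>F (X + t M)\<close> as polynomials in \<open>t\<close>; the leading
  coefficient of the divisor is the constant \<open>F M\<close>. At every \<open>A\<close> for which \<open>F (A + t M)\<close> is separable,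
  the remainder has \<open>N\<close> roots but degree less than \<open>N\<close>. Separability is an open condition on \<open>A\<close>, and
  it holds for the cyclic shift and \<open>M = diag \<mu>\<close>, where the \<open>\<mu>\<^sub>k\<close> are the roots of \<open>x\<^sup>r - r x\<close>. Hence
  the remainder is zero, and \<open>t = 0\<close> shows that \<open>F\<close> divides \<open>G\<close>. So \<open>F\<close> generates the vanishing
  ideal, and \<open>N\<close> is the degree. By the Euler sequence \<open>0 \<rightarrow> O \<rightarrow> O(1)\<^sup>r \<rightarrow> T \<rightarrow> 0\<close>, the Chern number
  of the statement is \<open>r choose (r - 2) = N / 2\<close>.
\<close>

section \<open>Evaluation of polynomials\<close>

definition mono_eval :: "('v \<Rightarrow> 'b::comm_ring_1) \<Rightarrow> ('v \<Rightarrow>\<^sub>0 nat) \<Rightarrow> 'b" where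
  "mono_eval x m = (\<Prod>v\<in>Poly_Mapping.keys m. x v ^ Poly_Mapping.lookup m v)"

text \<open>The coefficients pass through a ring homomorphism \<open>h\<close>, so that a single
  notion covers evaluation at scalars, restriction to a line (values in univariate polynomials) and
  substitution of polynomials for the variables.\<close>

definition poly_eval ::
  "('a::comm_ring_1 \<Rightarrow> 'b::comm_ring_1) \<Rightarrow> ('v \<Rightarrow> 'b) \<Rightarrow> (('v \<Rightarrow>\<^sub>0 nat) \<Rightarrow>\<^sub>0 'a) \<Rightarrow> 'b" where
  "poly_eval h x F = (\<Sum>m\<in>Poly_Mapping.keys F. h (Poly_Mapping.lookup F m) * mono_eval x m)"

abbreviation indet :: "'v \<Rightarrow> ('v \<Rightarrow>\<^sub>0 nat) \<Rightarrow>\<^sub>0 'a::comm_ring_1" where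
  "indet v \<equiv> Poly_Mapping.single (Poly_Mapping.single v 1) 1"

abbreviation const_poly :: "'a::comm_ring_1 \<Rightarrow> ('v \<Rightarrow>\<^sub>0 nat) \<Rightarrow>\<^sub>0 'a" where
  "const_poly c \<equiv> Poly_Mapping.single 0 c"

lemma mono_eval_superset:
  assumes "finite V" "Poly_Mapping.keys m \<subseteq> V"
  shows "mono_eval x m = (\<Prod>v\<in>V. x v ^ Poly_Mapping.lookup m v)"
  unfolding mono_eval_def using assms
  by (intro prod.mono_neutral_left) (auto simp: in_keys_iff)

lemma mono_eval_0 [simp]: "mono_eval x 0 = 1"
  by (simp add: mono_eval_def)

lemma mono_eval_single [simp]: "mono_eval x (Poly_Mapping.single v k) = x v ^ k"
  by (simp add: mono_eval_def)

lemma mono_eval_add: "mono_eval x (m + n) = mono_eval x m * mono_eval x n"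
proof -
  let ?V = "Poly_Mapping.keys m \<union> Poly_Mapping.keys n"
  have "Poly_Mapping.keys (m + n) \<subseteq> ?V" by (rule Poly_Mapping.keys_add)
  then show ?thesis
    by (simp add: mono_eval_superset[of ?V] lookup_add power_add prod.distrib)
qed

lemma mono_eval_times: "mono_eval (\<lambda>v. x v * y v) m = mono_eval x m * mono_eval y m"
  by (simp add: mono_eval_def power_mult_distrib prod.distrib)

lemma poly_mapping_sum_singles:
  "F = (\<Sum>m\<in>Poly_Mapping.keys F. Poly_Mapping.single m (Poly_Mapping.lookup F m))"
  by (rule poly_mapping_eqI) (simp add: lookup_sum lookup_single when_def in_keys_iff)

context comm_ring_hom
begin

lemma poly_eval_superset:
  assumes "finite K" "Poly_Mapping.keys F \<subseteq> K"
  shows "poly_eval hom x F = (\<Sum>m\<in>K. hom (Poly_Mapping.lookup F m) * mono_eval x m)"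
  unfolding poly_eval_def using assms
  by (intro sum.mono_neutral_left) (auto simp: in_keys_iff)

lemma poly_eval_0 [simp]: "poly_eval hom x 0 = 0"
  by (simp add: poly_eval_def)

lemma poly_eval_single [simp]: "poly_eval hom x (Poly_Mapping.single m c) = hom c * mono_eval x m"
  by (simp add: poly_eval_def)

lemma poly_eval_add: "poly_eval hom x (F + G) = poly_eval hom x F + poly_eval hom x G"
proof -
  let ?K = "Poly_Mapping.keys F \<union> Poly_Mapping.keys G"
  have "Poly_Mapping.keys (F + G) \<subseteq> ?K" by (rule Poly_Mapping.keys_add)
  then show ?thesis
    by (simp add: poly_eval_superset[of ?K] lookup_add hom_add sum.distrib algebra_simps)
qed

lemma poly_eval_sum: "poly_eval hom x (sum f S) = (\<Sum>s\<in>S. poly_eval hom x (f s))"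
  by (induction S rule: infinite_finite_induct) (auto simp: poly_eval_add)

lemma poly_eval_mult: "poly_eval hom x (F * G) = poly_eval hom x F * poly_eval hom x G"
proof -
  have "F * G = (\<Sum>m\<in>Poly_Mapping.keys F. \<Sum>n\<in>Poly_Mapping.keys G.
      Poly_Mapping.single (m + n) (Poly_Mapping.lookup F m * Poly_Mapping.lookup G n))"
    using arg_cong2[OF poly_mapping_sum_singles[of F] poly_mapping_sum_singles[of G], of "(*)"]
    by (simp only: sum_product mult_single)
  then show ?thesis
    by (simp only: poly_eval_sum poly_eval_single mono_eval_add hom_mult)
       (simp add: poly_eval_def sum_product mult_ac)
qed

lemma comm_ring_hom_poly_eval: "comm_ring_hom (poly_eval hom x)"
  by unfold_locales (auto simp: poly_eval_add poly_eval_mult simp flip: single_one)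

end

lemma poly_eval_comp:
  assumes "comm_ring_hom g" "comm_ring_hom h"
  shows "g (poly_eval h x F) = poly_eval (g \<circ> h) (g \<circ> x) F"
proof -
  interpret g: comm_ring_hom g by fact
  show ?thesis
    by (simp add: poly_eval_def mono_eval_def g.hom_sum g.hom_mult g.hom_prod g.hom_power)
qed

lemma comm_ring_hom_comp: "comm_ring_hom g \<Longrightarrow> comm_ring_hom h \<Longrightarrow> comm_ring_hom (g \<circ> h)"
  by (auto simp: comm_ring_hom_def Ring_Hom.ring_hom_def semiring_hom_def comm_monoid_add_hom_def
      monoid_mult_hom_def monoid_add_hom_def semigroup_add_hom_def semigroup_mult_hom_def
      zero_hom_def one_hom_def plus_hom_def times_hom_def)

lemma comm_ring_hom_ident: "comm_ring_hom (\<lambda>a. a)"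
  by unfold_locales auto

lemma comm_ring_hom_const_poly: "comm_ring_hom const_poly"
  by unfold_locales (auto simp: single_add mult_single)

lemma poly_eval_indet: "poly_eval const_poly indet F = F"
proof -
  have "mono_eval indet m = Poly_Mapping.single m (1 :: 'b)" for m :: "'a \<Rightarrow>\<^sub>0 nat"
  proof -
    have pow: "indet v ^ k = Poly_Mapping.single (Poly_Mapping.single v k) (1::'b)" for v :: 'a and k
      by (induction k) (auto simp: mult_single simp flip: single_add)
    have "(\<Prod>v\<in>S. Poly_Mapping.single (Poly_Mapping.single v (Poly_Mapping.lookup m v)) (1::'b))
        = Poly_Mapping.single (\<Sum>v\<in>S. Poly_Mapping.single v (Poly_Mapping.lookup m v)) 1"
      if "finite S" for S
      using that by induction (auto simp: mult_single)
    then show ?thesis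
      unfolding mono_eval_def pow by (simp flip: poly_mapping_sum_singles)
  qed
  then show ?thesis
    by (simp add: poly_eval_def mult_single flip: poly_mapping_sum_singles)
qed

text \<open>Assign 2 to one variable in which the exponents differ and 1 to all others; in
  characteristic 0 different powers of 2 are different.\<close>

lemma mono_eval_distinct:
  fixes m n :: "'v \<Rightarrow>\<^sub>0 nat"
  assumes "m \<noteq> n"
  obtains y :: "'v \<Rightarrow> 'b::{comm_ring_1,ring_char_0}" where "mono_eval y m \<noteq> mono_eval y n"
proof -
  from assms obtain v where v: "Poly_Mapping.lookup m v \<noteq> Poly_Mapping.lookup n v"
    by (metis poly_mapping_eqI)
  define y where "y = (\<lambda>u. if u = v then 2 else (1::'b))"
  have *: "mono_eval y k = 2 ^ Poly_Mapping.lookup k v" for k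
  proof -
    have "mono_eval y k = (\<Prod>u\<in>insert v (Poly_Mapping.keys k). y u ^ Poly_Mapping.lookup k u)"
      by (rule mono_eval_superset) auto
    also have "\<dots> = (\<Prod>u\<in>{v}. y u ^ Poly_Mapping.lookup k u)"
      by (rule prod.mono_neutral_right) (auto simp: y_def)
    finally show ?thesis by (simp add: y_def)
  qed
  have "(2::'b) ^ i \<noteq> 2 ^ j" if "i \<noteq> j" for i j
  proof
    assume "(2::'b) ^ i = 2 ^ j"
    then have "of_nat (2 ^ i) = (of_nat (2 ^ j) :: 'b)" by simp
    then show False using that by (simp only: of_nat_eq_iff) simp
  qed
  with v have "mono_eval y m \<noteq> mono_eval y n" by (simp add: *)
  then show ?thesis by (rule that)
qed

text \<open>Dedekind's argument: distinct monomials are distinct characters of the multiplicative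
  monoid of all assignments, hence linearly independent.\<close>

lemma mono_eval_independent:
  fixes c :: "('v \<Rightarrow>\<^sub>0 nat) \<Rightarrow> 'b::{idom,ring_char_0}"
  assumes "finite K" and "\<And>x. (\<Sum>m\<in>K. c m * mono_eval x m) = 0"
  shows "\<forall>m\<in>K. c m = 0"
  using assms
proof (induction K arbitrary: c rule: finite_induct)
  case (insert n K)
  \<comment> \<open>Substituting the products \<open>x v * y v\<close> and subtracting
    \<open>mono_eval y n\<close> times the original relation cancels the term of \<open>n\<close>.
    What remains is a shorter relation, to which the induction hypothesis applies.\<close>
  have zero: "\<forall>m\<in>K. c m * (mono_eval y m - mono_eval y n) = 0" for y
  proof (rule insert.IH)
    fix x
    have "0 = (\<Sum>m\<in>insert n K. c m * mono_eval (\<lambda>v. x v * y v) m)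
            - mono_eval y n * (\<Sum>m\<in>insert n K. c m * mono_eval x m)"
      by (simp only: insert.prems) simp
    also have "\<dots> = (\<Sum>m\<in>K. c m * mono_eval (\<lambda>v. x v * y v) m)
            - mono_eval y n * (\<Sum>m\<in>K. c m * mono_eval x m)"
      using insert.hyps by (simp add: mono_eval_times algebra_simps)
    also have "\<dots> = (\<Sum>m\<in>K. c m * (mono_eval y m - mono_eval y n) * mono_eval x m)"
      by (simp add: mono_eval_times sum_distrib_left algebra_simps flip: sum_subtractf)
    finally show "(\<Sum>m\<in>K. c m * (mono_eval y m - mono_eval y n) * mono_eval x m) = 0" by simp
  qed
  have K: "c m = 0" if "m \<in> K" for m
  proof -
    have "m \<noteq> n" using that insert.hyps by auto
    then obtain y :: "'v \<Rightarrow> 'b" where "mono_eval y m \<noteq> mono_eval y n"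
      by (rule mono_eval_distinct)
    then show ?thesis using zero[of y] that by auto
  qed
  have "(\<Sum>m\<in>insert n K. c m * mono_eval (\<lambda>_. 1) m) = 0" by (rule insert.prems)
  with insert.hyps K have "c n * mono_eval (\<lambda>_. 1) n = 0" by simp
  then have "c n = 0" by (simp add: mono_eval_def)
  with K show ?case by auto
qed simp

lemma poly_eval_zero_imp_zero:
  fixes F :: "('v \<Rightarrow>\<^sub>0 nat) \<Rightarrow>\<^sub>0 'a::{idom,ring_char_0}"
  assumes "\<And>x. poly_eval (\<lambda>a. a) x F = 0"
  shows "F = 0"
proof -
  have "\<forall>m\<in>Poly_Mapping.keys F. Poly_Mapping.lookup F m = 0"
    by (rule mono_eval_independent) (use assms in \<open>auto simp: poly_eval_def\<close>)
  then show ?thesis by (metis in_keys_iff poly_mapping_eqI lookup_zero)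
qed

lemma eval_mat_poly_eq: "eval_mat_poly F A = poly_eval (\<lambda>a. a) (($$) A) F"
  by (simp add: eval_mat_poly_def poly_eval_def mono_eval_def)

section \<open>Subrings of the polynomial ring\<close>

lemma mat_polys_0: "0 \<in> mat_polys r"
  by (simp add: mat_polys_def)

lemma mat_polys_single:
  "Poly_Mapping.keys m \<subseteq> {..<r} \<times> {..<r} \<Longrightarrow> Poly_Mapping.single m c \<in> mat_polys r"
  by (simp add: mat_polys_def)

lemma mat_polys_add: "F \<in> mat_polys r \<Longrightarrow> G \<in> mat_polys r \<Longrightarrow> F + G \<in> mat_polys r"
  using Poly_Mapping.keys_add[of F G] by (auto simp: mat_polys_def)

lemma mat_polys_mult:
  assumes "F \<in> mat_polys r" "G \<in> mat_polys r"
  shows "F * G \<in> mat_polys r"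
  unfolding mat_polys_def
proof (intro CollectI ballI)
  fix k assume "k \<in> Poly_Mapping.keys (F * G)"
  then obtain m n where "k = m + n" "m \<in> Poly_Mapping.keys F" "n \<in> Poly_Mapping.keys G"
    using keys_mult by blast
  with assms show "Poly_Mapping.keys k \<subseteq> {..<r} \<times> {..<r}"
    unfolding mat_polys_def using Poly_Mapping.keys_add[of m n] by blast
qed

lemma mat_polys_sum: "(\<And>s. s \<in> S \<Longrightarrow> f s \<in> mat_polys r) \<Longrightarrow> sum f S \<in> mat_polys r"
  by (induction S rule: infinite_finite_induct) (auto simp: mat_polys_0 mat_polys_add)

lemma mat_polys_power:
  assumes "F \<in> mat_polys r"
  shows "F ^ k \<in> mat_polys r"
  by (induction k) (use assms mat_polys_single[of 0 r 1] in \<open>auto simp: mat_polys_mult\<close>)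

lemma mat_polys_prod: "(\<And>s. s \<in> S \<Longrightarrow> f s \<in> mat_polys r) \<Longrightarrow> prod f S \<in> mat_polys r"
  by (induction S rule: infinite_finite_induct)
     (use mat_polys_single[of 0 r 1] in \<open>auto simp: mat_polys_mult\<close>)

lemma homogeneous_0: "homogeneous d 0"
  by (simp add: homogeneous_def)

lemma homogeneous_single:
  "(\<Sum>v\<in>Poly_Mapping.keys m. Poly_Mapping.lookup m v) = d \<Longrightarrow>
   homogeneous d (Poly_Mapping.single m c)"
  by (simp add: homogeneous_def)

lemma homogeneous_1: "homogeneous 0 1"
  using homogeneous_single[of 0 0 1] by simp

lemma homogeneous_add: "homogeneous d F \<Longrightarrow> homogeneous d G \<Longrightarrow> homogeneous d (F + G)"
  using Poly_Mapping.keys_add[of F G] by (auto simp: homogeneous_def)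

lemma total_degree_add:
  fixes m n :: "'v \<Rightarrow>\<^sub>0 nat"
  shows "(\<Sum>v\<in>Poly_Mapping.keys (m + n). Poly_Mapping.lookup (m + n) v) =
         (\<Sum>v\<in>Poly_Mapping.keys m. Poly_Mapping.lookup m v) +
         (\<Sum>v\<in>Poly_Mapping.keys n. Poly_Mapping.lookup n v)"
proof -
  let ?V = "Poly_Mapping.keys m \<union> Poly_Mapping.keys n"
  have *: "(\<Sum>v\<in>Poly_Mapping.keys k. Poly_Mapping.lookup k v) = (\<Sum>v\<in>?V. Poly_Mapping.lookup k v)"
    if "Poly_Mapping.keys k \<subseteq> ?V" for k :: "'v \<Rightarrow>\<^sub>0 nat"
    using that by (intro sum.mono_neutral_left) (auto simp: in_keys_iff)
  show ?thesis
    by (subst (1 2 3) *) (auto simp: lookup_add sum.distrib dest: subsetD[OF Poly_Mapping.keys_add])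
qed

lemma homogeneous_mult:
  assumes "homogeneous d F" "homogeneous e G"
  shows "homogeneous (d + e) (F * G)"
  unfolding homogeneous_def
proof
  fix k assume "k \<in> Poly_Mapping.keys (F * G)"
  then obtain m n where "k = m + n" "m \<in> Poly_Mapping.keys F" "n \<in> Poly_Mapping.keys G"
    using keys_mult by blast
  with assms show "(\<Sum>v\<in>Poly_Mapping.keys k. Poly_Mapping.lookup k v) = d + e"
    by (simp add: homogeneous_def total_degree_add)
qed

lemma homogeneous_sum: "(\<And>s. s \<in> S \<Longrightarrow> homogeneous d (f s)) \<Longrightarrow> homogeneous d (sum f S)"
  by (induction S rule: infinite_finite_induct) (auto simp: homogeneous_0 homogeneous_add)

lemma homogeneous_prod:
  "finite S \<Longrightarrow> (\<And>s. s \<in> S \<Longrightarrow> homogeneous (d s) (f s)) \<Longrightarrow>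
   homogeneous (sum d S) (prod f S)"
  by (induction S rule: finite_induct) (auto simp: homogeneous_1 homogeneous_mult)

section \<open>The discriminant of a matrix\<close>

definition mat_trace :: "'a::comm_ring_1 mat \<Rightarrow> 'a" where
  "mat_trace A = (\<Sum>i<dim_row A. A $$ (i, i))"

text \<open>By Vandermonde, the Hankel determinant of the power sums of the eigenvalues is the
  discriminant of the characteristic polynomial.\<close>

definition mat_disc :: "'a::comm_ring_1 mat \<Rightarrow> 'a" where
  "mat_disc A = det (mat (dim_row A) (dim_row A) (\<lambda>(i, j). mat_trace (A ^\<^sub>m (i + j))))"

lemma mat_trace_mult_comm:
  assumes "A \<in> carrier_mat n n" "B \<in> carrier_mat n n"
  shows "mat_trace (A * B) = mat_trace (B * A)"
proof -
  have *: "mat_trace (X * Y) = (\<Sum>i<n. \<Sum>j<n. X $$ (i, j) * Y $$ (j, i))"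
    if "X \<in> carrier_mat n n" "Y \<in> carrier_mat n n" for X Y :: "'a mat"
    using that by (simp add: mat_trace_def scalar_prod_def atLeast0LessThan)
  have "(\<Sum>i<n. \<Sum>j<n. A $$ (i, j) * B $$ (j, i)) = (\<Sum>i<n. \<Sum>j<n. B $$ (i, j) * A $$ (j, i))"
    by (subst sum.swap) (simp add: mult.commute)
  with assms show ?thesis by (simp add: *)
qed

lemma similar_matE:
  assumes "similar_mat A B"
  obtains n P Q where "A \<in> carrier_mat n n" "B \<in> carrier_mat n n" "P \<in> carrier_mat n n"
    "Q \<in> carrier_mat n n" "P * Q = 1\<^sub>m n" "Q * P = 1\<^sub>m n" "A = P * B * Q"
  using similar_matD[OF assms] by blast

lemma mat_trace_similar:
  assumes "similar_mat A B"
  shows "mat_trace A = mat_trace B"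
proof -
  obtain n P Q where B: "B \<in> carrier_mat n n" and P: "P \<in> carrier_mat n n"
    and Q: "Q \<in> carrier_mat n n" and QP: "Q * P = 1\<^sub>m n" and A: "A = P * B * Q"
    by (rule similar_matE[OF assms])
  have "mat_trace A = mat_trace (Q * (P * B))"
    unfolding A using P B by (intro mat_trace_mult_comm[OF _ Q]) simp
  also have "Q * (P * B) = Q * P * B" using P Q B by (simp add: assoc_mult_mat[of Q n n P n B n])
  finally show ?thesis using QP B by simp
qed

lemma mat_disc_similar:
  assumes "similar_mat A B"
  shows "mat_disc A = mat_disc B"
proof -
  obtain n where "A \<in> carrier_mat n n" "B \<in> carrier_mat n n"
    by (rule similar_matE[OF assms])
  then have dims: "dim_row A = n" "dim_row B = n" by auto
  have "mat_trace (A ^\<^sub>m k) = mat_trace (B ^\<^sub>m k)" for k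
  proof (rule mat_trace_similar)
    show "similar_mat (A ^\<^sub>m k) (B ^\<^sub>m k)"
      using assms similar_mat_wit_pow unfolding similar_mat_def by blast
  qed
  then show ?thesis by (simp add: mat_disc_def dims)
qed

text \<open>The discriminant is a universal integer polynomial in the entries, so it commutes with
  every ring homomorphism. This links the generic matrix, pencils and their specializations.\<close>

lemma (in comm_ring_hom) mat_disc_hom:
  assumes "A \<in> carrier_mat n n"
  shows "mat_disc (map_mat hom A) = hom (mat_disc A)"
proof -
  have tr: "mat_trace (map_mat hom X) = hom (mat_trace X)" if "X \<in> carrier_mat n n" for X
    using that by (simp add: mat_trace_def hom_sum)
  have "mat_disc (map_mat hom A) =
      det (mat n n (\<lambda>(i, j). hom (mat_trace (A ^\<^sub>m (i + j)))))"
    using assms by (simp add: mat_disc_def tr flip: mat_hom_pow[OF assms])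
  also have "\<dots> = det (map_mat hom (mat n n (\<lambda>(i, j). mat_trace (A ^\<^sub>m (i + j)))))"
    by (intro arg_cong[of _ _ det] eq_matI) auto
  finally show ?thesis using assms by (simp add: mat_disc_def hom_det)
qed

section \<open>Vandermonde determinants\<close>

definition vandermonde :: "nat \<Rightarrow> (nat \<Rightarrow> 'a::comm_ring_1) \<Rightarrow> 'a mat" where
  "vandermonde n f = mat n n (\<lambda>(k, i). f k ^ i)"

text \<open>The Hankel matrix of the power sums factors as \<open>transpose_mat V * V\<close> with
  \<open>V\<close> the Vandermonde matrix.\<close>

lemma det_power_sums:
  "det (mat n n (\<lambda>(i, j). \<Sum>k<n. f k ^ (i + j))) = det (vandermonde n f) ^ 2"
proof -
  let ?V = "vandermonde n f"
  have V: "?V \<in> carrier_mat n n" by (simp add: vandermonde_def)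
  have "mat n n (\<lambda>(i, j). \<Sum>k<n. f k ^ (i + j)) = transpose_mat ?V * ?V"
    by (rule eq_matI)
       (auto simp: vandermonde_def scalar_prod_def power_add atLeast0LessThan)
  then show ?thesis
    using V by (simp add: det_mult[of _ n] det_transpose[OF V] power2_eq_square)
qed

lemma det_vandermonde_eq_0:
  assumes "k < n" "l < n" "k \<noteq> l" "f k = f l"
  shows "det (vandermonde n f) = 0"
  by (rule det_identical_rows[of _ n k l])
     (use assms in \<open>auto simp: vandermonde_def intro!: eq_vecI\<close>)

lemma nonzero_vec_index:
  assumes "v \<in> carrier_vec n" "v \<noteq> 0\<^sub>v n"
  obtains i where "i < n" "v $ i \<noteq> 0"
proof -
  have "v = 0\<^sub>v n" if "\<forall>i<n. v $ i = 0"
    using assms(1) that by (intro eq_vecI) auto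
  with assms(2) have "\<exists>i<n. v $ i \<noteq> 0" by auto
  then show ?thesis using that by auto
qed

text \<open>A nonzero kernel vector would be the coefficient list of a nonzero polynomial of degree
  less than \<open>n\<close> that vanishes at the \<open>n\<close> distinct points
  \<open>f k\<close>.\<close>

lemma det_vandermonde_neq_0:
  fixes f :: "nat \<Rightarrow> 'a::field"
  assumes "inj_on f {..<n}"
  shows "det (vandermonde n f) \<noteq> 0"
proof
  have V: "vandermonde n f \<in> carrier_mat n n" by (simp add: vandermonde_def)
  assume "det (vandermonde n f) = 0"
  then obtain v where v: "v \<in> carrier_vec n" "v \<noteq> 0\<^sub>v n" "vandermonde n f *\<^sub>v v = 0\<^sub>v n"
    using det_0_iff_vec_prod_zero_field[OF V] by auto
  define p where "p = (\<Sum>i<n. monom (v $ i) i)"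
  have coeff: "coeff p i = (if i < n then v $ i else 0)" for i
    by (simp add: p_def coeff_sum)
  obtain i where i: "i < n" "v $ i \<noteq> 0"
    using nonzero_vec_index[OF v(1,2)] .
  then have "p \<noteq> 0" using coeff[of i] by auto
  have "degree p < n"
    using coeff[of "degree p"] \<open>p \<noteq> 0\<close> by (metis leading_coeff_0_iff)
  moreover have "f ` {..<n} \<subseteq> {x. poly p x = 0}"
  proof clarify
    fix k assume "k < n"
    have "0 = (vandermonde n f *\<^sub>v v) $ k" using v \<open>k < n\<close> by simp
    also have "\<dots> = poly p (f k)"
      using v(1) \<open>k < n\<close>
      by (simp add: vandermonde_def scalar_prod_def p_def poly_sum poly_monom mult.commute
          atLeast0LessThan)
    finally show "poly p (f k) = 0" by simp
  qed
  then have "card (f ` {..<n}) \<le> card {x. poly p x = 0}"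
    by (rule card_mono[OF poly_roots_finite[OF \<open>p \<noteq> 0\<close>]])
  then have "n \<le> card {x. poly p x = 0}" by (simp add: card_image[OF assms])
  ultimately show False using card_poly_roots_bound[OF \<open>p \<noteq> 0\<close>] by simp
qed

section \<open>Triangular matrices and triangularization\<close>

lemma upper_triangular_mult:
  assumes "A \<in> carrier_mat n n" "B \<in> carrier_mat n n" "upper_triangular A" "upper_triangular B"
  shows "upper_triangular (A * B)"
    and "i < n \<Longrightarrow> (A * B) $$ (i, i) = A $$ (i, i) * B $$ (i, i)"
proof -
  have index: "(A * B) $$ (i, j) = (\<Sum>l<n. A $$ (i, l) * B $$ (l, j))" if "i < n" "j < n" for i j
    using assms that by (simp add: scalar_prod_def atLeast0LessThan)
  have zero: "A $$ (i, l) = 0 \<or> B $$ (l, j) = 0" if "l < i \<or> j < l" "i < n" "l < n" for i j l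
    using assms that upper_triangularD[of A l i] upper_triangularD[of B j l] by auto
  show "upper_triangular (A * B)"
  proof (rule upper_triangularI)
    fix i j assume ij: "j < i" "i < dim_row (A * B)"
    then have ij': "i < n" "j < n" using assms by auto
    have "A $$ (i, l) * B $$ (l, j) = 0" if "l < n" for l
      using zero[of l i j] that ij ij' by (cases "l < i") auto
    then show "(A * B) $$ (i, j) = 0" unfolding index[OF ij'] by simp
  qed
  show "(A * B) $$ (i, i) = A $$ (i, i) * B $$ (i, i)" if "i < n"
  proof -
    have "(\<Sum>l<n. A $$ (i, l) * B $$ (l, i)) = (\<Sum>l\<in>{i}. A $$ (i, l) * B $$ (l, i))"
    proof (rule sum.mono_neutral_right)
      show "\<forall>l\<in>{..<n} - {i}. A $$ (i, l) * B $$ (l, i) = 0"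
      proof
        fix l assume "l \<in> {..<n} - {i}"
        then have "A $$ (i, l) = 0 \<or> B $$ (l, i) = 0" using that by (intro zero) auto
        then show "A $$ (i, l) * B $$ (l, i) = 0" by auto
      qed
    qed (use that in auto)
    with index[OF that that] show ?thesis by simp
  qed
qed

lemma upper_triangular_pow:
  assumes "A \<in> carrier_mat n n" "upper_triangular A"
  shows "upper_triangular (A ^\<^sub>m k) \<and> (\<forall>i<n. (A ^\<^sub>m k) $$ (i, i) = A $$ (i, i) ^ k)"
proof (induction k)
  case 0
  with assms show ?case by auto
next
  case (Suc k)
  have "A ^\<^sub>m k \<in> carrier_mat n n" using assms by simp
  from upper_triangular_mult[OF this assms(1) _ assms(2)] Suc show ?case
    by (auto simp: power_commutes simp del: index_mult_mat(1))
qed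

text \<open>Powers of a triangular matrix have the powers of the diagonal entries on their diagonal,
  so the traces are power sums.\<close>

lemma mat_disc_upper_triangular:
  assumes "A \<in> carrier_mat n n" "upper_triangular A"
  shows "mat_disc A = det (vandermonde n (\<lambda>k. A $$ (k, k))) ^ 2"
proof -
  have "mat_trace (A ^\<^sub>m k) = (\<Sum>i<n. A $$ (i, i) ^ k)" for k
    using assms upper_triangular_pow[OF assms, of k] by (auto simp: mat_trace_def)
  with assms show ?thesis by (simp add: mat_disc_def det_power_sums)
qed

lemma mat_disc_upper_triangular_eq_0_iff:
  fixes A :: "'a::field mat"
  assumes "A \<in> carrier_mat n n" "upper_triangular A"
  shows "mat_disc A = 0 \<longleftrightarrow> \<not> inj_on (\<lambda>k. A $$ (k, k)) {..<n}"
proof -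
  have "det (vandermonde n (\<lambda>k. A $$ (k, k))) = 0" if "\<not> inj_on (\<lambda>k. A $$ (k, k)) {..<n}"
  proof -
    from that obtain k l where "k < n" "l < n" "k \<noteq> l" "A $$ (k, k) = A $$ (l, l)"
      by (auto simp: inj_on_def)
    then show ?thesis by (rule det_vandermonde_eq_0)
  qed
  moreover have "det (vandermonde n (\<lambda>k. A $$ (k, k))) \<noteq> 0" if "inj_on (\<lambda>k. A $$ (k, k)) {..<n}"
    using that by (rule det_vandermonde_neq_0)
  ultimately show ?thesis unfolding mat_disc_upper_triangular[OF assms] by auto
qed

lemma det_neq_0_inverse:
  fixes P :: "'a::field mat"
  assumes "P \<in> carrier_mat n n" "det P \<noteq> 0"
  obtains Q where "Q \<in> carrier_mat n n" "P * Q = 1\<^sub>m n" "Q * P = 1\<^sub>m n"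
  using det_non_zero_imp_unit[OF assms, of "()"] that
  by (auto simp: Units_def ring_mat_def)

text \<open>Choose \<open>k\<close> with \<open>v $ k\<close> nonzero, take the permutation matrix
  of the transposition of 0 and \<open>k\<close>, and overwrite its first column by
  \<open>v\<close>.\<close>

lemma invertible_with_first_column:
  fixes v :: "'a::field vec"
  assumes "v \<in> carrier_vec n" "v \<noteq> 0\<^sub>v n"
  obtains P Q where "P \<in> carrier_mat n n" "Q \<in> carrier_mat n n" "P * Q = 1\<^sub>m n" "Q * P = 1\<^sub>m n"
    "col P 0 = v"
proof -
  obtain k where k: "k < n" "v $ k \<noteq> 0"
    using nonzero_vec_index[OF assms] .
  define \<sigma> where "\<sigma> = Transposition.transpose 0 k"
  define P where "P = mat n n (\<lambda>(i, j). if j = 0 then v $ i else if i = \<sigma> j then 1 else 0)"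
  have P: "P \<in> carrier_mat n n" by (simp add: P_def)
  have \<sigma>: "\<sigma> (\<sigma> i) = i" "i < n \<Longrightarrow> \<sigma> i < n" for i
    using k by (auto simp: \<sigma>_def Transposition.transpose_def)
  have "det P \<noteq> 0"
  proof
    assume "det P = 0"
    then obtain c where c: "c \<in> carrier_vec n" "c \<noteq> 0\<^sub>v n" "P *\<^sub>v c = 0\<^sub>v n"
      using det_0_iff_vec_prod_zero_field[OF P] by auto
    have row: "v $ i * c $ 0 + (if \<sigma> i = 0 then 0 else c $ \<sigma> i) = 0" if "i < n" for i
    proof -
      obtain m where n: "n = Suc m" using k by (cases n) auto
      have "0 = (P *\<^sub>v c) $ i" using c that by simp
      also have "\<dots> = (\<Sum>j=0..<Suc m. (if j = 0 then v $ i else if i = \<sigma> j then 1 else 0) * c $ j)"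
        using that c(1) n by (simp add: P_def scalar_prod_def del: sum.op_ivl_Suc)
      also have "\<dots> = v $ i * c $ 0 + (\<Sum>j=0..<m. (if i = \<sigma> (Suc j) then 1 else 0) * c $ Suc j)"
        by (subst sum.atLeast0_lessThan_Suc_shift) simp
      also have "(\<Sum>j=0..<m. (if i = \<sigma> (Suc j) then 1 else 0) * c $ Suc j) =
          (\<Sum>j=0..<m. if j = \<sigma> i - 1 \<and> \<sigma> i \<noteq> 0 then c $ \<sigma> i else 0)"
      proof (rule sum.cong)
        fix x
        show "(if i = \<sigma> (Suc x) then 1 else 0) * c $ Suc x =
          (if x = \<sigma> i - 1 \<and> \<sigma> i \<noteq> 0 then c $ \<sigma> i else 0)"
        proof (cases "i = \<sigma> (Suc x)")
          case True
          then show ?thesis using \<sigma>(1)[of "Suc x"] by simp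
        next
          case False
          then have "\<sigma> i \<noteq> Suc x" using \<sigma>(1)[of i] by auto
          with False show ?thesis by auto
        qed
      qed simp
      also have "\<dots> = (if \<sigma> i = 0 then 0 else c $ \<sigma> i)"
        using \<sigma>(2)[OF that] n by auto
      finally show ?thesis by simp
    qed
    \<comment> \<open>In row \<open>k\<close> only the first column contributes, which gives
      \<open>c $ 0 = 0\<close>. After that, row \<open>\<sigma> i\<close> reads off
      \<open>c $ i\<close>.\<close>
    have "\<sigma> k = 0" by (simp add: \<sigma>_def)
    with row[OF k(1)] k have c0: "c $ 0 = 0" by simp
    have "c $ i = 0" if "i < n" for i
      using row[of "\<sigma> i"] \<sigma> that c0 by (cases "i = 0") auto
    then show False using nonzero_vec_index[OF c(1,2)] by blast
  qed
  then obtain Q where "Q \<in> carrier_mat n n" "P * Q = 1\<^sub>m n" "Q * P = 1\<^sub>m n"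
    using det_neq_0_inverse[OF P] by blast
  moreover have "col P 0 = v"
    using k assms by (intro eq_vecI) (auto simp: P_def)
  ultimately show ?thesis using P that by blast
qed

text \<open>An eigenvector as first vector of a new basis makes the first column a multiple of the
  first unit vector. The lower right block is then triangularized by induction.\<close>

lemma triangularizable:
  fixes A :: "'a::alg_closed_field mat"
  assumes "A \<in> carrier_mat n n"
  shows "\<exists>T\<in>carrier_mat n n. upper_triangular T \<and> similar_mat A T"
  using assms
proof (induction n arbitrary: A)
  case 0
  then show ?case
    by (intro bexI[of _ A]) (auto intro: similar_mat_refl)
next
  case (Suc m)
  have "degree (char_poly A) > 0"
    using degree_monic_char_poly[OF Suc.prems] by simp
  then obtain e where "poly (char_poly A) e = 0" using alg_closed_imp_poly_has_root by blast
  then obtain v where v: "v \<in> carrier_vec (Suc m)" "v \<noteq> 0\<^sub>v (Suc m)" "A *\<^sub>v v = e \<cdot>\<^sub>v v"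
    using eigenvalue_root_char_poly[OF Suc.prems] Suc.prems
    by (auto simp: eigenvalue_def eigenvector_def)
  obtain P Q where PQ: "P \<in> carrier_mat (Suc m) (Suc m)" "Q \<in> carrier_mat (Suc m) (Suc m)"
    "P * Q = 1\<^sub>m (Suc m)" "Q * P = 1\<^sub>m (Suc m)" "col P 0 = v"
    using invertible_with_first_column[OF v(1,2)] by blast
  define A' where "A' = Q * A * P"
  have A': "A' \<in> carrier_mat (Suc m) (Suc m)" using PQ Suc.prems by (simp add: A'_def)
  have sim: "similar_mat A A'"
  proof (rule similar_mat_sym, rule similar_matI[of _ _ Q P "Suc m"])
    show "A' = Q * A * P" by (simp add: A'_def)
  qed (use PQ A' Suc.prems in auto)
  have c1: "col A' 0 = (Q * A) *\<^sub>v v"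
    unfolding A'_def PQ(5)[symmetric] by (rule col_mult2[OF _ PQ(1)]) (use PQ(2) Suc.prems in auto)
  have c2: "(Q * A) *\<^sub>v v = Q *\<^sub>v (e \<cdot>\<^sub>v v)"
    unfolding v(3)[symmetric] by (rule assoc_mult_mat_vec[OF PQ(2) Suc.prems v(1)])
  have c3: "Q *\<^sub>v (e \<cdot>\<^sub>v v) = e \<cdot>\<^sub>v (Q *\<^sub>v v)"
    by (rule mult_mat_vec[OF PQ(2) v(1)])
  have c4: "Q *\<^sub>v v = unit_vec (Suc m) 0"
    using col_mult2[OF PQ(2,1), of 0] unfolding PQ(4,5) by simp
  have col0: "col A' 0 = e \<cdot>\<^sub>v unit_vec (Suc m) 0"
    unfolding c1 c2 c3 c4 ..
  obtain A1 A2 A0 A3 where split: "split_block A' 1 1 = (A1, A2, A0, A3)"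
    by (rule prod_cases4)
  have "dim_row A' = 1 + m" "dim_col A' = 1 + m" using A' by auto
  note blocks = split_block[OF split this]
  have "A0 = 0\<^sub>m m 1"
  proof (rule eq_matI)
    fix i j assume ij: "i < dim_row (0\<^sub>m m 1 :: 'a mat)" "j < dim_col (0\<^sub>m m 1 :: 'a mat)"
    then have "A0 $$ (i, j) = A' $$ (Suc i, 0)"
      using blocks(1-4) by (subst blocks(5)) auto
    also have "\<dots> = col A' 0 $ Suc i" using ij A' by auto
    also have "\<dots> = 0" unfolding col0 using ij by simp
    finally show "A0 $$ (i, j) = 0\<^sub>m m 1 $$ (i, j)" using ij by simp
  qed (use blocks(3) in auto)
  obtain T where T: "T \<in> carrier_mat m m" "upper_triangular T" "similar_mat A3 T"
    using Suc.IH[OF blocks(4)] by blast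
  then obtain P' Q' where wit: "similar_mat_wit A3 T P' Q'" by (auto simp: similar_mat_def)
  note P' = similar_mat_witD2[OF blocks(4) wit]
  \<comment> \<open>Conjugation by the block diagonal matrix of 1 and \<open>P'\<close>
    triangularizes the lower block; it changes \<open>A2\<close> but keeps \<open>A1\<close> and the
    zero block.\<close>
  have "similar_mat_wit (four_block_mat A1 A2 A0 A3) (four_block_mat A1 (A2 * P') A0 T)
      (four_block_mat (1\<^sub>m 1) (0\<^sub>m 1 m) (0\<^sub>m m 1) P') (four_block_mat (1\<^sub>m 1) (0\<^sub>m 1 m) (0\<^sub>m m 1) Q')"
    by (rule similar_mat_wit_four_block[OF similar_mat_wit_refl[OF blocks(1)] wit])
       (use blocks(1-4) P' \<open>A0 = 0\<^sub>m m 1\<close> in auto)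
  then have "similar_mat A (four_block_mat A1 (A2 * P') A0 T)"
    using sim blocks(5) similar_mat_trans unfolding similar_mat_def by blast
  moreover have "upper_triangular (four_block_mat A1 (A2 * P') A0 T)"
    unfolding \<open>A0 = 0\<^sub>m m 1\<close> using blocks(1) T
    by (intro upper_triangular_four_block[of _ 1 _ m]) auto
  moreover have "four_block_mat A1 (A2 * P') A0 T \<in> carrier_mat (Suc m) (Suc m)"
    using blocks(1) T(1) four_block_carrier_mat[of A1 1 1 T m m] by simp
  ultimately show ?case by blast
qed

section \<open>Diagonalizability and the discriminant\<close>

lemma order_linear_factors_le_1:
  fixes a :: "'a::field"
  assumes "distinct xs"
  shows "order a (\<Prod>x\<leftarrow>xs. [:- x, 1:]) \<le> 1"
proof -
  have "order a (\<Prod>x\<leftarrow>xs. [:- x, 1:]) = (\<Sum>x\<leftarrow>xs. if x = a then 1 else 0)"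
    by (subst order_prod_list) (auto simp: o_def order_linear' intro!: arg_cong[of _ _ sum_list])
  also have "\<dots> \<le> 1" using assms
  proof (induction xs)
    case (Cons y ys)
    have "(\<Sum>x\<leftarrow>zs. if x = y then 1 else 0) = (0::nat)" if "y \<notin> set zs" for zs
      using that by (induction zs) auto
    with Cons show ?case by auto
  qed simp
  finally show ?thesis .
qed

lemma diagonal_mat_jordan_matrix:
  assumes "\<And>n a. (n, a) \<in> set n_as \<Longrightarrow> n = 1"
  shows "diagonal_mat (jordan_matrix n_as)"
  using assms
proof (induction n_as)
  case Nil
  then show ?case by (simp add: jordan_matrix_def diagonal_mat_def)
next
  case (Cons na n_as)
  obtain a where na: "na = (1, a)" using Cons.prems[of "fst na" "snd na"] by (cases na) auto
  have IH: "diagonal_mat (jordan_matrix n_as)" using Cons by auto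
  show ?case
    unfolding na jordan_matrix_Cons diagonal_mat_def using IH
    by (auto simp: diagonal_mat_def less_Suc_eq_0_disj) blast
qed

text \<open>If the discriminant is nonzero, a triangular form has distinct diagonal entries, so the
  characteristic polynomial has only simple roots. The size of a Jordan block is bounded by the
  order of its root, hence all blocks have size 1.\<close>

lemma not_diagonalizable_imp_mat_disc_eq_0:
  fixes A :: "'a::alg_closed_field mat"
  assumes A: "A \<in> carrier_mat n n" and "\<not> diagonalizable_mat A"
  shows "mat_disc A = 0"
proof (rule ccontr)
  assume "mat_disc A \<noteq> 0"
  obtain T where T: "T \<in> carrier_mat n n" "upper_triangular T" "similar_mat A T"
    using triangularizable[OF A] by blast
  have "inj_on (\<lambda>k. T $$ (k, k)) {..<n}"
    using \<open>mat_disc A \<noteq> 0\<close> mat_disc_similar[OF T(3)] mat_disc_upper_triangular_eq_0_iff[OF T(1,2)]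
    by simp
  then have "distinct (diag_mat T)"
    using T(1) by (auto simp: diag_mat_def distinct_map atLeast0LessThan)
  then have order: "order a (char_poly T) \<le> 1" for a
    unfolding char_poly_upper_triangular[OF T(1,2)] by (rule order_linear_factors_le_1)
  obtain n_as where jnf: "jordan_nf T n_as" using triangular_to_jnf_vector[OF T(1,2)] by blast
  have "k = 1" if "(k, a) \<in> set n_as" for k a
  proof -
    have "k \<noteq> 0" using jnf that by (force simp: jordan_nf_def)
    moreover have "k \<le> 1" using jordan_nf_block_size_order_bound[OF jnf that] order[of a] by simp
    ultimately show ?thesis by simp
  qed
  then have "diagonal_mat (jordan_matrix n_as)" by (rule diagonal_mat_jordan_matrix)
  moreover have "similar_mat A (jordan_matrix n_as)"
    using similar_mat_trans[OF T(3)] jnf by (simp add: jordan_nf_def)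
  ultimately show False using assms(2) by (auto simp: diagonalizable_mat_def)
qed

lemma diagonal_mult_vec_index:
  assumes "D \<in> carrier_mat n n" "diagonal_mat D" "v \<in> carrier_vec n" "i < n"
  shows "(D *\<^sub>v v) $ i = D $$ (i, i) * v $ i"
proof -
  have "(D *\<^sub>v v) $ i = (\<Sum>j=0..<n. D $$ (i, j) * v $ j)"
    using assms by (simp add: scalar_prod_def)
  also have "\<dots> = (\<Sum>j\<in>{i}. D $$ (i, j) * v $ j)"
    using assms by (intro sum.mono_neutral_right) (auto simp: diagonal_mat_def)
  finally show ?thesis by simp
qed

text \<open>In coordinates that diagonalize \<open>A\<close>, each index gives
  \<open>(d - x) * v' = 0\<close> and \<open>(d - x) * w' = v'\<close>, where \<open>d\<close> is
  the diagonal entry and \<open>v'\<close>, \<open>w'\<close> are the coordinates of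
  \<open>v\<close>, \<open>w\<close>. Whether or not \<open>d = x\<close>, this forces
  \<open>v' = 0\<close>.\<close>

lemma jordan_chain_not_diagonalizable:
  fixes A :: "'a::field mat"
  assumes A: "A \<in> carrier_mat n n" and v: "v \<in> carrier_vec n" and w: "w \<in> carrier_vec n"
    and Av: "A *\<^sub>v v = x \<cdot>\<^sub>v v" and Aw: "A *\<^sub>v w = x \<cdot>\<^sub>v w + v" and "v \<noteq> 0\<^sub>v n"
  shows "\<not> diagonalizable_mat A"
proof
  assume "diagonalizable_mat A"
  then obtain D where D: "diagonal_mat D" "similar_mat A D" by (auto simp: diagonalizable_mat_def)
  then obtain P Q where "similar_mat_wit A D P Q" by (auto simp: similar_mat_def)
  note PQ = similar_mat_witD2[OF A this]
  have "Q * A = Q * (P * (D * Q))" using PQ by (simp add: assoc_mult_mat[of P n n D n Q n])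
  also have "\<dots> = (Q * P) * (D * Q)" using PQ by (intro assoc_mult_mat[symmetric]) auto
  also have "\<dots> = D * Q" unfolding PQ(2) using PQ by (intro left_mult_one_mat) auto
  finally have QA: "Q * A = D * Q" .
  have QA': "D *\<^sub>v (Q *\<^sub>v u) = Q *\<^sub>v (A *\<^sub>v u)" if "u \<in> carrier_vec n" for u
    using assoc_mult_mat_vec[OF PQ(7) A that] assoc_mult_mat_vec[OF PQ(5,7) that] QA by simp
  have dims: "dim_row Q = n" "dim_row P = n" using PQ by auto
  have Qv: "Q *\<^sub>v v \<in> carrier_vec n" and Qw: "Q *\<^sub>v w \<in> carrier_vec n" using PQ v w by auto
  have "(Q *\<^sub>v v) $ i = 0" if "i < n" for i
  proof -
    have "D $$ (i, i) * (Q *\<^sub>v v) $ i = (Q *\<^sub>v (x \<cdot>\<^sub>v v)) $ i"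
      using diagonal_mult_vec_index[OF PQ(5) D(1) Qv that] QA'[OF v] Av by simp
    also have "\<dots> = x * (Q *\<^sub>v v) $ i" using mult_mat_vec[OF PQ(7) v] dims that by simp
    finally have 1: "D $$ (i, i) * (Q *\<^sub>v v) $ i = x * (Q *\<^sub>v v) $ i" .
    have "D $$ (i, i) * (Q *\<^sub>v w) $ i = (Q *\<^sub>v (x \<cdot>\<^sub>v w + v)) $ i"
      using diagonal_mult_vec_index[OF PQ(5) D(1) Qw that] QA'[OF w] Aw by simp
    also have "Q *\<^sub>v (x \<cdot>\<^sub>v w + v) = x \<cdot>\<^sub>v (Q *\<^sub>v w) + Q *\<^sub>v v"
      using mult_add_distrib_mat_vec[OF PQ(7), of "x \<cdot>\<^sub>v w" v] v w mult_mat_vec[OF PQ(7) w] by simp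
    also have "(x \<cdot>\<^sub>v (Q *\<^sub>v w) + Q *\<^sub>v v) $ i = x * (Q *\<^sub>v w) $ i + (Q *\<^sub>v v) $ i"
      using dims that by simp
    finally have 2: "D $$ (i, i) * (Q *\<^sub>v w) $ i = x * (Q *\<^sub>v w) $ i + (Q *\<^sub>v v) $ i" .
    show ?thesis using 1 2 by (cases "D $$ (i, i) = x") auto
  qed
  then have "Q *\<^sub>v v = 0\<^sub>v n" using dims by (intro eq_vecI) auto
  then have "P *\<^sub>v (Q *\<^sub>v v) = 0\<^sub>v n" using PQ(6) by (auto intro!: eq_vecI)
  moreover have "P *\<^sub>v (Q *\<^sub>v v) = v"
    using assoc_mult_mat_vec[OF PQ(6,7) v] PQ(1) v by simp
  ultimately show False using \<open>v \<noteq> 0\<^sub>v n\<close> by simp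
qed

section \<open>Companion matrices\<close>

text \<open>In this orientation the vector of powers of a root is an eigenvector. For monic
  \<open>p\<close> of degree \<open>n\<close>, \<open>mat_disc (companion n p)\<close> serves as the
  discriminant of \<open>p\<close>: it is polynomial in the coefficients and detects
  separability.\<close>

definition companion :: "nat \<Rightarrow> 'a::comm_ring_1 poly \<Rightarrow> 'a mat" where
  "companion n p = mat n n (\<lambda>(i, j).
     if Suc i < n then if j = Suc i then 1 else 0 else - coeff p j)"

lemma companion_carrier [simp]: "companion n p \<in> carrier_mat n n"
  by (simp add: companion_def)

lemma companion_dim [simp]: "dim_row (companion n p) = n" "dim_col (companion n p) = n"
  by (simp_all add: companion_def)

lemma (in comm_ring_hom) companion_hom: "map_mat hom (companion n p) = companion n (map_poly hom p)"
  by (rule eq_matI) (auto simp: companion_def coeff_map_poly hom_uminus)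

lemma companion_mult_vec:
  assumes "w \<in> carrier_vec n" "i < n"
  shows "(companion n p *\<^sub>v w) $ i =
    (if Suc i < n then w $ Suc i else - (\<Sum>j<n. coeff p j * w $ j))"
proof -
  have "(companion n p *\<^sub>v w) $ i =
      (\<Sum>j<n. (if Suc i < n then if j = Suc i then 1 else 0 else - coeff p j) * w $ j)"
    using assms by (simp add: companion_def scalar_prod_def atLeast0LessThan)
  also have "\<dots> = (if Suc i < n then w $ Suc i else - (\<Sum>j<n. coeff p j * w $ j))"
  proof (cases "Suc i < n")
    case True
    then have "(\<Sum>j<n. (if j = Suc i then 1 else 0) * w $ j) =
        (\<Sum>j\<in>{Suc i}. (if j = Suc i then 1 else 0) * w $ j)"
      by (intro sum.mono_neutral_right) auto
    with True show ?thesis by simp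
  qed (simp add: sum_negf)
  finally show ?thesis .
qed

lemma poly_monic_sum:
  fixes p :: "'a::comm_ring_1 poly"
  assumes "degree p = n" "coeff p n = 1"
  shows "poly p x = (\<Sum>j<n. coeff p j * x ^ j) + x ^ n"
  unfolding poly_altdef assms(1) lessThan_Suc_atMost[symmetric] by (simp add: assms(2))

text \<open>The transposed Vandermonde matrix of the roots has eigenvectors as columns, so it
  diagonalizes the companion matrix with the distinct roots on the diagonal.\<close>

lemma mat_disc_companion_neq_0:
  fixes p :: "'a::field poly"
  assumes p: "degree p = n" "coeff p n = 1" and x: "inj_on x {..<n}" "\<And>k. k < n \<Longrightarrow> poly p (x k) = 0"
  shows "mat_disc (companion n p) \<noteq> 0"
proof -
  let ?C = "companion n p"
  define W where "W = transpose_mat (vandermonde n x)"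
  define L where "L = mat n n (\<lambda>(i, j). if i = j then x i else 0)"
  have V: "vandermonde n x \<in> carrier_mat n n" by (simp add: vandermonde_def)
  have W: "W \<in> carrier_mat n n" using V by (simp add: W_def)
  have L: "L \<in> carrier_mat n n" by (simp add: L_def)
  have "det W \<noteq> 0" unfolding W_def det_transpose[OF V] by (rule det_vandermonde_neq_0[OF x(1)])
  then obtain Q where Q: "Q \<in> carrier_mat n n" "W * Q = 1\<^sub>m n" "Q * W = 1\<^sub>m n"
    using det_neq_0_inverse[OF W] by blast
  have "?C * W = W * L"
  proof (rule eq_matI)
    fix i k assume "i < dim_row (W * L)" "k < dim_col (W * L)"
    then have ik: "i < n" "k < n" using W L by auto
    have col: "col W k = vec n (\<lambda>j. x k ^ j)"
      using ik by (intro eq_vecI) (auto simp: W_def vandermonde_def)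
    have "(?C * W) $$ (i, k) = (?C *\<^sub>v col W k) $ i"
      using ik W by simp
    also have "\<dots> = (if Suc i < n then x k ^ Suc i else - (\<Sum>j<n. coeff p j * x k ^ j))"
      unfolding col using ik by (subst companion_mult_vec) auto
    also have "\<dots> = x k ^ Suc i"
    \<comment> \<open>Only the last row uses that \<open>x k\<close> is a root; the other rows
      merely shift the powers.\<close>
    proof (cases "Suc i < n")
      case False
      then have "n = Suc i" using ik by simp
      then show ?thesis
        using x(2)[OF ik(2)] unfolding poly_monic_sum[OF p] by (simp add: add_eq_0_iff2)
    qed simp
    also have "\<dots> = (\<Sum>j\<in>{k}. x j ^ i * (if j = k then x j else 0))" by simp
    also have "\<dots> = (\<Sum>j<n. x j ^ i * (if j = k then x j else 0))"
      using ik by (intro sum.mono_neutral_left) auto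
    also have "\<dots> = (W * L) $$ (i, k)"
      using ik by (simp add: W_def L_def vandermonde_def scalar_prod_def atLeast0LessThan)
    finally show "(?C * W) $$ (i, k) = (W * L) $$ (i, k)" .
  qed (use W L in auto)
  then have "?C = W * L * Q"
    using assoc_mult_mat[OF companion_carrier W Q(1), of p] Q(2) by simp
  then have "similar_mat ?C L"
    using W L Q by (intro similar_matI[of _ _ W Q n]) auto
  then have "mat_disc ?C = mat_disc L" by (rule mat_disc_similar)
  moreover have "upper_triangular L" by (auto simp: L_def)
  moreover have "inj_on (\<lambda>k. L $$ (k, k)) {..<n}" using x(1) by (simp add: L_def inj_on_def)
  ultimately show ?thesis
    using mat_disc_upper_triangular_eq_0_iff[OF L] by simp
qed

text \<open>The upper rows of the eigenvector equation force \<open>w $ i = e ^ i * w $ 0\<close>,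
  and the last row then says \<open>poly p e * w $ 0 = 0\<close>.\<close>

lemma companion_eigenvalue_root:
  fixes p :: "'a::field poly"
  assumes p: "degree p = n" "coeff p n = 1" and "eigenvalue (companion n p) e"
  shows "poly p e = 0"
proof -
  obtain w where w: "w \<in> carrier_vec n" "w \<noteq> 0\<^sub>v n" "companion n p *\<^sub>v w = e \<cdot>\<^sub>v w"
    using assms(3) carrier_matD(1)[OF companion_carrier[of n p]]
    by (auto simp: eigenvalue_def eigenvector_def)
  have row: "(if Suc i < n then w $ Suc i else - (\<Sum>j<n. coeff p j * w $ j)) = e * w $ i"
    if "i < n" for i
    using companion_mult_vec[OF w(1) that, of p] w that by simp
  have pow: "w $ i = e ^ i * w $ 0" if "i < n" for i
    using that
  proof (induction i)
    case (Suc i)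
    then show ?case using row[of i] by (simp add: mult.assoc)
  qed simp
  obtain i where i: "i < n" "w $ i \<noteq> 0" using nonzero_vec_index[OF w(1,2)] .
  then have w0: "w $ 0 \<noteq> 0" using pow[OF i(1)] by (metis mult_zero_right)
  obtain m where m: "n = Suc m" using i by (cases n) auto
  have "- (\<Sum>j<n. coeff p j * w $ j) = e * w $ m" using row[of m] m by simp
  also have "\<dots> = e ^ n * w $ 0" using pow[of m] m by simp
  also have "(\<Sum>j<n. coeff p j * w $ j) = (\<Sum>j<n. coeff p j * e ^ j) * w $ 0"
    unfolding sum_distrib_right
  proof (rule sum.cong)
    fix j assume "j \<in> {..<n}"
    then show "coeff p j * w $ j = coeff p j * e ^ j * w $ 0"
      by (subst pow) (auto simp: mult.assoc)
  qed simp
  finally have "- ((\<Sum>j<n. coeff p j * e ^ j) * w $ 0) = e ^ n * w $ 0" .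
  then have "poly p e * w $ 0 = 0"
    unfolding poly_monic_sum[OF p] distrib_right by (metis add.right_inverse)
  with w0 show ?thesis by simp
qed

text \<open>The converse of \<open>mat_disc_companion_neq_0\<close>: the diagonal of a triangular
  form of the companion matrix lists \<open>n\<close> distinct eigenvalues, and these are
  roots.\<close>

lemma companion_distinct_roots:
  fixes p :: "'a::alg_closed_field poly"
  assumes p: "degree p = n" "coeff p n = 1" and "mat_disc (companion n p) \<noteq> 0"
  obtains x where "inj_on x {..<n}" "\<And>k. k < n \<Longrightarrow> poly p (x k) = 0"
proof -
  let ?C = "companion n p"
  obtain T where T: "T \<in> carrier_mat n n" "upper_triangular T" "similar_mat ?C T"
    using triangularizable[OF companion_carrier[of n p]] by blast
  have "inj_on (\<lambda>k. T $$ (k, k)) {..<n}"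
    using assms(3) mat_disc_similar[OF T(3)] mat_disc_upper_triangular_eq_0_iff[OF T(1,2)]
    by simp
  moreover have "poly p (T $$ (k, k)) = 0" if "k < n" for k
  proof (rule companion_eigenvalue_root[OF p])
    have "T $$ (k, k) \<in> set (diag_mat T)" using that T(1) by (auto simp: diag_mat_def)
    then have "poly (char_poly T) (T $$ (k, k)) = 0"
      unfolding char_poly_upper_triangular[OF T(1,2)]
      by (auto simp: poly_prod_list prod_list_zero_iff o_def)
    then show "eigenvalue ?C (T $$ (k, k))"
      using eigenvalue_root_char_poly[OF companion_carrier[of n p]] char_poly_similar[OF T(3)]
      by simp
  qed
  ultimately show ?thesis by (rule that)
qed

section \<open>Pencils of matrices\<close>

definition pencil :: "'a::comm_ring_1 mat \<Rightarrow> 'a mat \<Rightarrow> 'a poly mat" where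
  "pencil A M = mat (dim_row A) (dim_col A) (\<lambda>ij. [:A $$ ij, M $$ ij:])"

lemma comm_ring_hom_constant: "comm_ring_hom (\<lambda>a::'a::comm_ring_1. [:a:])"
  by unfold_locales (auto simp: one_pCons)

lemma pencil_carrier [simp]: "A \<in> carrier_mat n m \<Longrightarrow> pencil A M \<in> carrier_mat n m"
  by (simp add: pencil_def)

lemma pencil_eq:
  assumes "A \<in> carrier_mat n n" "M \<in> carrier_mat n n"
  shows "pencil A M = map_mat (\<lambda>a. [:a:]) A + [:0, 1:] \<cdot>\<^sub>m map_mat (\<lambda>a. [:a:]) M"
  using assms by (intro eq_matI) (auto simp: pencil_def)

lemma poly_pencil:
  assumes "A \<in> carrier_mat n n" "M \<in> carrier_mat n n"
  shows "map_mat (\<lambda>p. poly p t) (pencil A M) = A + t \<cdot>\<^sub>m M"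
  using assms by (intro eq_matI) (auto simp: pencil_def)

lemma comm_ring_hom_poly_at: "comm_ring_hom (\<lambda>p::'a::comm_ring_1 poly. poly p t)"
  by unfold_locales auto

lemma poly_mat_disc_pencil:
  assumes "A \<in> carrier_mat n n" "M \<in> carrier_mat n n"
  shows "poly (mat_disc (pencil A M)) t = mat_disc (A + t \<cdot>\<^sub>m M)"
  using comm_ring_hom.mat_disc_hom[OF comm_ring_hom_poly_at, of "pencil A M" n t] assms
  by (simp add: poly_pencil[OF assms])

text \<open>The constant matrices \<open>P\<close> and \<open>Q\<close> remain mutually inverse over
  the polynomial ring, and conjugation with them acts on both terms of \<open>A + t M\<close>. This
  reduces the case of diagonalizable \<open>A\<close> to that of diagonal \<open>A\<close>.\<close>

lemma similar_pencil:
  assumes "similar_mat_wit A D P Q" "A \<in> carrier_mat n n" and M: "M \<in> carrier_mat n n"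
  shows "similar_mat (pencil A M) (pencil D (Q * M * P))"
proof -
  interpret C: comm_ring_hom "\<lambda>a::'a. [:a:]" by (rule comm_ring_hom_constant)
  note w = similar_mat_witD2[OF assms(2,1)]
  let ?C = "map_mat (\<lambda>a::'a. [:a:])" and ?t = "[:0, 1::'a:]"
  have cP: "?C P \<in> carrier_mat n n" and cQ: "?C Q \<in> carrier_mat n n" and cD: "?C D \<in> carrier_mat n n"
    and cM: "?C M \<in> carrier_mat n n" and N: "Q * M * P \<in> carrier_mat n n"
    and cN: "?C (Q * M * P) \<in> carrier_mat n n"
    using w M by auto
  have inv: "?C P * ?C Q = 1\<^sub>m n" "?C Q * ?C P = 1\<^sub>m n"
    using C.mat_hom_mult[OF w(6,7)] C.mat_hom_mult[OF w(7,6)] w(1,2) by (simp_all add: C.mat_hom_one)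
  have "P * (Q * M * P) = P * (Q * (M * P))" using w M by (simp add: assoc_mult_mat[of _ n n _ n _ n])
  also have "\<dots> = (P * Q) * (M * P)"
    using w M by (intro assoc_mult_mat[symmetric, of _ n n _ n _ n]) auto
  finally have "P * (Q * M * P) = M * P" using w(1) M w(6) by simp
  then have "P * (Q * M * P) * Q = M * (P * Q)"
    using w M by (simp add: assoc_mult_mat[of _ n n _ n _ n])
  then have PNQ: "P * (Q * M * P) * Q = M" using w(1) M by simp
  have "?C P * pencil D (Q * M * P) * ?C Q =
      ?C P * (?C D + ?t \<cdot>\<^sub>m ?C (Q * M * P)) * ?C Q"
    by (simp only: pencil_eq[OF w(5) N])
  also have "\<dots> = (?C P * ?C D + ?C P * (?t \<cdot>\<^sub>m ?C (Q * M * P))) * ?C Q"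
    using mult_add_distrib_mat[OF cP cD, of "?t \<cdot>\<^sub>m ?C (Q * M * P)"] cN by simp
  also have "?C P * (?t \<cdot>\<^sub>m ?C (Q * M * P)) = ?t \<cdot>\<^sub>m (?C P * ?C (Q * M * P))"
    by (rule mult_smult_distrib[OF cP cN])
  also have "(?C P * ?C D + ?t \<cdot>\<^sub>m (?C P * ?C (Q * M * P))) * ?C Q =
      ?C P * ?C D * ?C Q + ?t \<cdot>\<^sub>m (?C P * ?C (Q * M * P)) * ?C Q"
    by (rule add_mult_distrib_mat[of _ n n _ _ n]) (use cP cD cN cQ in auto)
  also have "?t \<cdot>\<^sub>m (?C P * ?C (Q * M * P)) * ?C Q = ?t \<cdot>\<^sub>m (?C P * ?C (Q * M * P) * ?C Q)"
    by (rule mult_smult_assoc_mat[of _ n n _ n]) (use cP cN cQ in auto)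
  also have "?C P * ?C D * ?C Q = ?C A"
    using C.mat_hom_mult[OF w(6,5)] C.mat_hom_mult[of "P * D" n n Q n] w by simp
  also have "?C P * ?C (Q * M * P) * ?C Q = ?C M"
    using C.mat_hom_mult[OF w(6) N] C.mat_hom_mult[of "P * (Q * M * P)" n n Q n] w N PNQ by simp
  finally have "pencil A M = ?C P * pencil D (Q * M * P) * ?C Q"
    using pencil_eq[OF assms(2) M] by simp
  then show ?thesis
    using inv cP cQ w(4,5) by (intro similar_matI[of _ _ "?C P" "?C Q" n]) auto
qed

section \<open>Discriminants of pencils modulo the square of t\<close>

lemma det_cong:
  fixes A B :: "'a::field poly mat"
  assumes "A \<in> carrier_mat n n" "B \<in> carrier_mat n n"
    and "\<And>i j. i < n \<Longrightarrow> j < n \<Longrightarrow> [A $$ (i, j) = B $$ (i, j)] (mod m)"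
  shows "[det A = det B] (mod m)"
  unfolding det_def'[OF assms(1)] det_def'[OF assms(2)]
proof (intro cong_sum cong_mult cong_refl cong_prod)
  fix p i assume "p \<in> {p. p permutes {0..<n}}" "i \<in> {0..<n}"
  then show "[A $$ (i, p i) = B $$ (i, p i)] (mod m)"
    using permutes_in_image[of p "{0..<n}" i] by (intro assms(3)) auto
qed

text \<open>Modulo \<open>t\<^sup>2\<close> the eigenvalues of \<open>D + t N\<close>, with \<open>D\<close> diagonal, behave like its diagonal entries.\<close>

lemma pencil_diagonal_pow:
  fixes D N :: "'a::field mat"
  assumes D: "D \<in> carrier_mat n n" "diagonal_mat D" and N: "N \<in> carrier_mat n n"
    and ij: "i < n" "j < n"
  shows "if i = j then [(pencil D N ^\<^sub>m k) $$ (i, i) = pencil D N $$ (i, i) ^ k] (mod [:0, 1:]\<^sup>2)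
    else [:0, 1:] dvd (pencil D N ^\<^sub>m k) $$ (i, j)"
  using ij
proof (induction k arbitrary: i j)
  case 0
  with D show ?case by (auto simp: pencil_def)
next
  case (Suc k)
  let ?X = "pencil D N" and ?t = "[:0, 1::'a:]"
  have X: "?X \<in> carrier_mat n n" using D by simp
  have offdiag: "?t dvd ?X $$ (a, b)" if "a < n" "b < n" "a \<noteq> b" for a b
    using that D by (simp add: pencil_def diagonal_mat_def dvd_def)
  have Y: "?X ^\<^sub>m k \<in> carrier_mat n n" using X by simp
  have expand: "(?X ^\<^sub>m Suc k) $$ (i, j) = (\<Sum>l<n. (?X ^\<^sub>m k) $$ (i, l) * ?X $$ (l, j))"
    using X Y Suc.prems by (simp add: scalar_prod_def atLeast0LessThan)
  show ?case
  proof (cases "i = j")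
    case False
    have "?t dvd (?X ^\<^sub>m k) $$ (i, l) * ?X $$ (l, j)" if "l < n" for l
      using offdiag[of l j] Suc.IH[of i l] that Suc.prems False
      by (cases "l = i") (auto intro: dvd_mult dvd_mult2)
    with False show ?thesis unfolding expand by (auto intro: dvd_sum)
  next
    case True
    \<comment> \<open>For \<open>l \<noteq> i\<close> both factors are off-diagonal and thus
      divisible by t, so only the diagonal term survives modulo the square of t.\<close>
    have "[(?X ^\<^sub>m k) $$ (i, l) * ?X $$ (l, i) = 0] (mod ?t\<^sup>2)" if "l < n" "l \<noteq> i" for l
      unfolding cong_0_iff power2_eq_square
      using offdiag[of l i] Suc.IH[of i l] that Suc.prems by (intro mult_dvd_mono) auto
    then have "[(\<Sum>l<n. (?X ^\<^sub>m k) $$ (i, l) * ?X $$ (l, i)) =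
        (\<Sum>l<n. if l = i then ?X $$ (i, i) ^ k * ?X $$ (i, i) else 0)] (mod ?t\<^sup>2)"
      using Suc.IH[of i i] Suc.prems by (intro cong_sum) (auto intro!: cong_mult)
    with True Suc.prems show ?thesis using expand by (simp add: power_commutes del: pow_mat.simps)
  qed
qed

text \<open>Modulo the square of t the discriminant is the square of the Vandermonde determinant of
  the diagonal of \<open>D + t N\<close>. Two of these entries agree at t = 0, so that determinant
  is divisible by t.\<close>

lemma mat_disc_pencil_diagonal:
  fixes D N :: "'a::field mat"
  assumes D: "D \<in> carrier_mat n n" "diagonal_mat D" and N: "N \<in> carrier_mat n n"
    and "mat_disc D = 0"
  shows "[:0, 1:]\<^sup>2 dvd mat_disc (pencil D N)"
proof -
  let ?X = "pencil D N" and ?t = "[:0, 1::'a:]"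
  let ?f = "\<lambda>k. ?X $$ (k, k)"
  have X: "?X \<in> carrier_mat n n" using D by simp
  have "upper_triangular D" using D by (auto simp: diagonal_mat_def)
  then obtain k l where kl: "k < n" "l < n" "k \<noteq> l" "D $$ (k, k) = D $$ (l, l)"
    using mat_disc_upper_triangular_eq_0_iff[OF D(1)] assms(4) by (auto simp: inj_on_def)
  have "[mat_trace (?X ^\<^sub>m m) = (\<Sum>i<n. ?f i ^ m)] (mod ?t\<^sup>2)" for m
    using pencil_diagonal_pow[OF D N, of i i m for i] X by (auto simp: mat_trace_def intro!: cong_sum)
  then have "[mat_disc ?X = det (vandermonde n ?f) ^ 2] (mod ?t\<^sup>2)"
    unfolding mat_disc_def det_power_sums[symmetric] using X by (intro det_cong) auto
  moreover have "?t dvd det (vandermonde n ?f)"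
  proof -
    have "poly (det (vandermonde n ?f)) 0 = det (map_mat (\<lambda>p. poly p 0) (vandermonde n ?f))"
      by (rule comm_ring_hom.hom_det[OF comm_ring_hom_poly_at, symmetric])
    also have "map_mat (\<lambda>p. poly p 0) (vandermonde n ?f) = vandermonde n (\<lambda>k. D $$ (k, k))"
      using D by (intro eq_matI) (auto simp: vandermonde_def pencil_def)
    also have "det (vandermonde n (\<lambda>k. D $$ (k, k))) = 0"
      using kl by (rule det_vandermonde_eq_0)
    finally show ?thesis using poly_eq_0_iff_dvd[of "det (vandermonde n ?f)" 0] by simp
  qed
  then have "?t\<^sup>2 dvd det (vandermonde n ?f) ^ 2" by (rule dvd_power_same)
  ultimately show ?thesis by (simp only: cong_dvd_iff)
qed

lemma mat_disc_pencil_double_root: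
  fixes A M :: "'a::field mat"
  assumes A: "A \<in> carrier_mat n n" and M: "M \<in> carrier_mat n n"
    and "diagonalizable_mat A" "mat_disc A = 0"
  shows "[:0, 1:]\<^sup>2 dvd mat_disc (pencil A M)"
proof -
  obtain D P Q where D: "diagonal_mat D" "similar_mat_wit A D P Q"
    using assms(3) by (auto simp: diagonalizable_mat_def similar_mat_def)
  note w = similar_mat_witD2[OF A D(2)]
  have "mat_disc D = 0"
    using assms(4) mat_disc_similar[of A D] D(2) by (auto simp: similar_mat_def)
  then have "[:0, 1:]\<^sup>2 dvd mat_disc (pencil D (Q * M * P))"
    using D(1) w M by (intro mat_disc_pencil_diagonal[of _ n]) auto
  then show ?thesis using mat_disc_similar[OF similar_pencil[OF D(2) A M]] by simp
qed

text \<open>Shifting the parameter by \<open>t\<close> turns the discriminant along the pencil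
  through \<open>A\<close> into the one along the pencil through \<open>A + t M\<close>. If that
  matrix were diagonalizable, the latter would have a double root at 0, contradicting
  \<open>simple\<close>.\<close>

lemma simple_root_not_diagonalizable:
  fixes A M :: "'a::field mat"
  assumes A: "A \<in> carrier_mat n n" and M: "M \<in> carrier_mat n n"
    and root: "poly (mat_disc (pencil A M)) t = 0"
    and simple: "poly (pderiv (mat_disc (pencil A M))) t \<noteq> 0"
  shows "\<not> diagonalizable_mat (A + t \<cdot>\<^sub>m M)"
proof
  let ?p = "mat_disc (pencil A M)" and ?B = "A + t \<cdot>\<^sub>m M"
  have sh: "comm_ring_hom (\<lambda>p. p \<circ>\<^sub>p [:t, 1::'a:])"
    by unfold_locales (auto simp: pcompose_add pcompose_mult)
  assume "diagonalizable_mat ?B"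
  have B: "?B \<in> carrier_mat n n" using A M by simp
  have "mat_disc ?B = 0" using root by (simp add: poly_mat_disc_pencil[OF A M])
  then have "[:0, 1:]\<^sup>2 dvd mat_disc (pencil ?B M)"
    using mat_disc_pencil_double_root[OF B M] \<open>diagonalizable_mat ?B\<close> by blast
  also have "pencil ?B M = map_mat (\<lambda>p. p \<circ>\<^sub>p [:t, 1:]) (pencil A M)"
    using A M by (intro eq_matI) (auto simp: pencil_def pcompose_pCons mult.commute)
  also have "mat_disc \<dots> = ?p \<circ>\<^sub>p [:t, 1:]"
    using A by (intro comm_ring_hom.mat_disc_hom[OF sh, of _ n]) simp
  finally obtain q where q: "?p \<circ>\<^sub>p [:t, 1:] = [:0, 1:]\<^sup>2 * q" by (elim dvdE)
  have "poly (pderiv ?p) t = poly (pderiv (?p \<circ>\<^sub>p [:t, 1:])) 0"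
    by (simp add: pderiv_pcompose poly_pcompose pderiv_pCons)
  also have "\<dots> = 0" unfolding q by (simp add: pderiv_mult power2_eq_square pderiv_pCons)
  finally show False using simple by simp
qed

section \<open>Degree and top coefficient of the discriminant of a pencil\<close>

lemma coeff_mult_bound:
  assumes "degree p \<le> m" "degree q \<le> n"
  shows "coeff (p * q) (m + n) = coeff p m * (coeff q n :: 'a::comm_ring_1)"
proof -
  have "coeff p i * coeff q (m + n - i) = 0" if "i \<noteq> m" "i \<le> m + n" for i
  proof (cases "i < m")
    case True
    then have "degree q < m + n - i" using assms by simp
    then show ?thesis by (simp add: coeff_eq_0)
  next
    case False
    then have "degree p < i" using assms that by simp
    then show ?thesis by (simp add: coeff_eq_0)
  qed
  then have "(\<Sum>i\<le>m + n. coeff p i * coeff q (m + n - i)) =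
      (\<Sum>i\<in>{m}. coeff p i * coeff q (m + n - i))"
    by (intro sum.mono_neutral_right) auto
  then show ?thesis by (simp add: coeff_mult)
qed

lemma coeff_prod_bound:
  fixes f :: "'b \<Rightarrow> 'a::comm_ring_1 poly"
  assumes "finite S" "\<And>s. s \<in> S \<Longrightarrow> degree (f s) \<le> d s"
  shows "degree (prod f S) \<le> sum d S \<and> coeff (prod f S) (sum d S) = (\<Prod>s\<in>S. coeff (f s) (d s))"
  using assms
proof (induction S rule: finite_induct)
  case (insert s S)
  then have IH: "degree (prod f S) \<le> sum d S"
    "coeff (prod f S) (sum d S) = (\<Prod>s\<in>S. coeff (f s) (d s))" and s: "degree (f s) \<le> d s"
    by auto
  have "degree (f s * prod f S) \<le> d s + sum d S"
    using degree_mult_le[of "f s" "prod f S"] IH s by linarith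
  with insert.hyps coeff_mult_bound[OF s IH(1)] IH(2) show ?case by simp
qed simp

lemma pencil_pow_coeff:
  assumes A: "A \<in> carrier_mat n n" and M: "M \<in> carrier_mat n n" and "i < n" "j < n"
  shows "degree ((pencil A M ^\<^sub>m k) $$ (i, j)) \<le> k \<and>
    coeff ((pencil A M ^\<^sub>m k) $$ (i, j)) k = (M ^\<^sub>m k) $$ (i, j)"
  using assms(3,4)
proof (induction k arbitrary: i j)
  case 0
  with A M show ?case by (auto simp: pencil_def)
next
  case (Suc k)
  let ?X = "pencil A M"
  have X: "?X \<in> carrier_mat n n" using A by simp
  have Y: "?X ^\<^sub>m k \<in> carrier_mat n n" using X by simp
  have expand: "(?X ^\<^sub>m Suc k) $$ (i, j) = (\<Sum>l<n. (?X ^\<^sub>m k) $$ (i, l) * ?X $$ (l, j))"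
    using X Y Suc.prems by (simp add: scalar_prod_def atLeast0LessThan)
  have "M ^\<^sub>m k \<in> carrier_mat n n" using M by simp
  then have expand': "(M ^\<^sub>m Suc k) $$ (i, j) = (\<Sum>l<n. (M ^\<^sub>m k) $$ (i, l) * M $$ (l, j))"
    using M Suc.prems by (simp add: scalar_prod_def atLeast0LessThan)
  have X1: "degree (?X $$ (l, j)) \<le> 1" "coeff (?X $$ (l, j)) 1 = M $$ (l, j)" if "l < n" for l
    using A Suc.prems that by (auto simp: pencil_def)
  have "degree (\<Sum>l<n. (?X ^\<^sub>m k) $$ (i, l) * ?X $$ (l, j)) \<le> k + 1"
  proof (intro degree_sum_le ballI)
    fix l assume "l \<in> {..<n}"
    then show "degree ((?X ^\<^sub>m k) $$ (i, l) * ?X $$ (l, j)) \<le> k + 1"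
      using Suc.IH[of i l] X1(1)[of l] Suc.prems
        degree_mult_le[of "(?X ^\<^sub>m k) $$ (i, l)" "?X $$ (l, j)"] by simp
  qed simp
  moreover have "coeff (\<Sum>l<n. (?X ^\<^sub>m k) $$ (i, l) * ?X $$ (l, j)) (k + 1) =
      (\<Sum>l<n. (M ^\<^sub>m k) $$ (i, l) * M $$ (l, j))"
    unfolding coeff_sum
  proof (rule sum.cong)
    fix l assume "l \<in> {..<n}"
    then show "coeff ((?X ^\<^sub>m k) $$ (i, l) * ?X $$ (l, j)) (k + 1) = (M ^\<^sub>m k) $$ (i, l) * M $$ (l, j)"
      using Suc.IH[of i l] X1[of l] Suc.prems by (subst coeff_mult_bound) auto
  qed simp
  ultimately show ?case unfolding expand expand' by simp
qed

text \<open>In the Leibniz expansion of \<open>mat_disc\<close>, the term of \<open>p\<close> is a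
  product of traces of the powers \<open>i + p i\<close>. This sum shows that all terms have the
  same degree, for pencils (as a bound in the parameter) and for the generic matrix.\<close>

lemma sum_permutation_degrees:
  assumes "p permutes {0..<n}"
  shows "(\<Sum>i = 0..<n. i + p i) = n * (n - 1 :: nat)"
proof -
  have "(\<Sum>i = 0..<n. p i) = (\<Sum>i = 0..<n. i)"
    using sum.permute[OF assms, of "\<lambda>i. i"] by (simp add: o_def)
  then have "(\<Sum>i = 0..<n. i + p i) = 2 * (\<Sum>i = 0..<n. i)" by (simp add: sum.distrib)
  also have "\<dots> = n * (n - 1)"
  proof (induction n)
    case (Suc n)
    then show ?case by (cases n) auto
  qed simp
  finally show ?thesis .
qed

lemma mat_disc_leibniz:
  assumes "A \<in> carrier_mat n n"
  shows "mat_disc A = (\<Sum>p | p permutes {0..<n}.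
    signof p * (\<Prod>i = 0..<n. mat_trace (A ^\<^sub>m (i + p i))))"
proof -
  have "mat n n (\<lambda>(i, j). mat_trace (A ^\<^sub>m (i + j))) $$ (i, p i) = mat_trace (A ^\<^sub>m (i + p i))"
    if "p permutes {0..<n}" "i \<in> {0..<n}" for p i
    using that permutes_in_image[of p "{0..<n}" i] by auto
  then show ?thesis
    unfolding mat_disc_def using assms
    by (subst det_def'[of _ n]) (auto intro!: sum.cong prod.cong arg_cong2[of _ _ _ _ "(*)"])
qed

text \<open>The part of top degree of a power of \<open>A + t M\<close> is the power of
  \<open>t M\<close>, so the coefficient of t to the \<open>n * (n - 1)\<close> depends only on
  \<open>M\<close>. When it is a unit, division with remainder by the discriminant becomes
  possible.\<close>

lemma mat_disc_pencil_coeff: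
  assumes A: "A \<in> carrier_mat n n" and M: "M \<in> carrier_mat n n"
  shows "degree (mat_disc (pencil A M)) \<le> n * (n - 1)"
    and "coeff (mat_disc (pencil A M)) (n * (n - 1)) = mat_disc M"
proof -
  let ?X = "pencil A M" and ?P = "{p. p permutes {0..<n}}"
  have X: "?X \<in> carrier_mat n n" using A by simp
  have tr: "degree (mat_trace (?X ^\<^sub>m k)) \<le> k \<and> coeff (mat_trace (?X ^\<^sub>m k)) k = mat_trace (M ^\<^sub>m k)" for k
    using X M pencil_pow_coeff[OF A M]
    by (auto simp: mat_trace_def coeff_sum intro!: degree_sum_le sum.cong)
  have prod: "degree (\<Prod>i = 0..<n. mat_trace (?X ^\<^sub>m (i + p i))) \<le> n * (n - 1) \<and>
    coeff (\<Prod>i = 0..<n. mat_trace (?X ^\<^sub>m (i + p i))) (n * (n - 1)) =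
      (\<Prod>i = 0..<n. mat_trace (M ^\<^sub>m (i + p i)))" if "p \<in> ?P" for p
    using coeff_prod_bound[of "{0..<n}" "\<lambda>i. mat_trace (?X ^\<^sub>m (i + p i))" "\<lambda>i. i + p i"] tr
      sum_permutation_degrees[of p n] that by simp_all
  have sgn: "signof p * q = Polynomial.smult (signof p) q" for p and q :: "'a poly"
    by (simp add: sign_def)
  show "degree (mat_disc ?X) \<le> n * (n - 1)"
    unfolding mat_disc_leibniz[OF X] sgn using prod
    by (intro degree_sum_le ballI) (auto intro: order.trans[OF degree_smult_le] simp: finite_permutations)
  show "coeff (mat_disc ?X) (n * (n - 1)) = mat_disc M"
    unfolding mat_disc_leibniz[OF X] mat_disc_leibniz[OF M] sgn coeff_sum using prod by (intro sum.cong) auto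
qed

section \<open>A pencil with separable discriminant\<close>

lemma distinct_roots_enumeration:
  fixes p :: "'a::alg_closed_field poly"
  assumes "p \<noteq> 0" "\<And>x. poly p x = 0 \<Longrightarrow> poly (pderiv p) x \<noteq> 0"
  shows "\<exists>\<mu>. inj_on \<mu> {..<degree p} \<and> p = Polynomial.smult (lead_coeff p) (\<Prod>k<degree p. [:- \<mu> k, 1:])"
  using assms
proof (induction "degree p" arbitrary: p)
  case 0
  then obtain c where "p = [:c:]" by (metis degree_eq_zeroE)
  with 0 show ?case by auto
next
  case (Suc n)
  then obtain a where a: "poly p a = 0" using alg_closed_imp_poly_has_root[of p] by auto
  define L where "L = [:- a, 1:]"
  have L: "poly L x = x - a" "pderiv L = 1" "lead_coeff L = 1" "L \<noteq> 0" "degree L = 1" for x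
    by (simp_all add: L_def pderiv_pCons)
  obtain q where q: "p = L * q" using a poly_eq_0_iff_dvd[of p a] by (auto simp: L_def elim: dvdE)
  have "q \<noteq> 0" using Suc.prems q by auto
  then have deg: "degree p = Suc (degree q)" unfolding q using L by (subst degree_mult_eq) auto
  have deriv: "pderiv p = q + L * pderiv q"
    unfolding q by (simp add: pderiv_mult L)
  \<comment> \<open>Since \<open>a\<close> is a simple root of \<open>p\<close>, it does not recur
    among the roots of \<open>q\<close>; appending it therefore keeps the enumeration
    injective.\<close>
  have qa: "poly q a \<noteq> 0" using Suc.prems(2)[OF a] unfolding deriv by (simp add: L)
  have "poly (pderiv q) x \<noteq> 0" if "poly q x = 0" for x
    using Suc.prems(2)[of x] that unfolding deriv by (simp add: q)
  then obtain \<mu> where \<mu>: "inj_on \<mu> {..<degree q}"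
    "q = Polynomial.smult (lead_coeff q) (\<Prod>k<degree q. [:- \<mu> k, 1:])"
    using Suc.hyps(1)[of q] Suc.hyps(2) deg \<open>q \<noteq> 0\<close> by auto
  define \<nu> where "\<nu> = \<mu>(degree q := a)"
  have "poly q (\<mu> k) = 0" if "k < degree q" for k
    by (subst \<mu>(2)) (use that in \<open>auto simp: poly_prod\<close>)
  then have "inj_on \<nu> {..<degree p}"
    using \<mu>(1) qa by (auto simp: \<nu>_def deg lessThan_Suc inj_on_def)
  moreover have "p = Polynomial.smult (lead_coeff p) (\<Prod>k<degree p. [:- \<nu> k, 1:])"
  proof -
    have "lead_coeff p = lead_coeff q" unfolding q lead_coeff_mult L(3) by simp
    moreover have "(\<Prod>k<degree q. [:- \<nu> k, 1:]) = (\<Prod>k<degree q. [:- \<mu> k, 1:])"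
      by (intro prod.cong) (auto simp: \<nu>_def)
    moreover have "\<nu> (degree q) = a" by (simp add: \<nu>_def)
    moreover have "p = Polynomial.smult (lead_coeff q) ((\<Prod>k<degree q. [:- \<mu> k, 1:]) * L)"
      using q \<mu>(2) by (metis mult.commute mult_smult_left)
    moreover have "(\<Prod>k<degree p. [:- \<nu> k, 1:]) = (\<Prod>k<degree q. [:- \<nu> k, 1:]) * [:- \<nu> (degree q), 1:]"
      unfolding deg by (rule prod.lessThan_Suc)
    ultimately show ?thesis unfolding L_def by (metis (lifting))
  qed
  ultimately show ?case by blast
qed

definition cyclic_shift :: "nat \<Rightarrow> 'a::comm_ring_1 mat" where
  "cyclic_shift n = mat n n (\<lambda>(i, j). if j = Suc i mod n then 1 else 0)"

lemma cyclic_pencil_mult_vec: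
  assumes "n \<ge> 2" "i < n" "v \<in> carrier_vec n"
  shows "((cyclic_shift n + t \<cdot>\<^sub>m mat_diag n \<mu>) *\<^sub>v v) $ i = v $ (Suc i mod n) + t * \<mu> i * v $ i"
proof -
  have m: "Suc i mod n < n" using assms by simp
  have "((cyclic_shift n + t \<cdot>\<^sub>m mat_diag n \<mu>) *\<^sub>v v) $ i =
      (\<Sum>j<n. ((if j = Suc i mod n then 1 else 0) + t * (if i = j then \<mu> j else 0)) * v $ j)"
    using assms by (simp add: cyclic_shift_def mat_diag_def scalar_prod_def atLeast0LessThan)
  also have "\<dots> = (\<Sum>j<n. (if j = Suc i mod n then v $ (Suc i mod n) else 0) +
      (if j = i then t * \<mu> i * v $ i else 0))"
    by (intro sum.cong) (auto simp: algebra_simps)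
  also have "\<dots> = v $ (Suc i mod n) + t * \<mu> i * v $ i"
    using assms m by (simp add: sum.distrib)
  finally show ?thesis .
qed

text \<open>The characteristic polynomial of the cyclic pencil is \<open>\<Prod>(x - t \<mu>\<^sub>k) - 1\<close>, and a double root
  of it comes with a Jordan chain: the eigenvector is the value, and the generalised eigenvector
  the derivative, of the vector of partial products.\<close>

lemma cyclic_pencil_not_diagonalizable:
  fixes \<mu> :: "nat \<Rightarrow> 'a::field"
  assumes n: "n \<ge> 2"
    and root: "poly (\<Prod>k<n. [:- (t * \<mu> k), 1:]) x = 1"
    and double: "poly (pderiv (\<Prod>k<n. [:- (t * \<mu> k), 1:])) x = 0"
  shows "\<not> diagonalizable_mat (cyclic_shift n + t \<cdot>\<^sub>m mat_diag n \<mu>)"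
proof -
  let ?A = "cyclic_shift n + t \<cdot>\<^sub>m mat_diag n \<mu>"
  define P where "P i = (\<Prod>k<i. [:- (t * \<mu> k), 1:])" for i
  \<comment> \<open>The first recursion is the eigenvector equation away from the last index; the
    second is its derivative in \<open>x\<close> and becomes the equation for the generalised
    eigenvector.\<close>
  have Suc: "poly (P (Suc i)) x = (x - t * \<mu> i) * poly (P i) x"
    "poly (pderiv (P (Suc i))) x = (x - t * \<mu> i) * poly (pderiv (P i)) x + poly (P i) x" for i
  proof -
    have "P (Suc i) = P i * [:- (t * \<mu> i), 1:]" by (simp add: P_def)
    then show "poly (P (Suc i)) x = (x - t * \<mu> i) * poly (P i) x"
      "poly (pderiv (P (Suc i))) x = (x - t * \<mu> i) * poly (pderiv (P i)) x + poly (P i) x"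
      by (simp_all add: pderiv_mult pderiv_pCons algebra_simps del: mult_pCons_right)
  qed
  have P0: "poly (P 0) x = 1" "poly (pderiv (P 0)) x = 0" by (simp_all add: P_def)
  have Pn: "poly (P n) x = 1" "poly (pderiv (P n)) x = 0" using root double by (simp_all add: P_def)
  \<comment> \<open>The recursions close up cyclically at \<open>i = n - 1\<close>:
    \<open>root\<close> and \<open>double\<close> say that \<open>P n\<close> and its derivative
    take the same values at \<open>x\<close> as \<open>P 0 = 1\<close> and its derivative.\<close>
  have modn: "poly (P (Suc i mod n)) x = poly (P (Suc i)) x"
    "poly (pderiv (P (Suc i mod n))) x = poly (pderiv (P (Suc i))) x" if "i < n" for i
    using that Pn P0 by (cases "Suc i = n"; simp)+
  define v where "v = vec n (\<lambda>i. poly (P i) x)"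
  define w where "w = vec n (\<lambda>i. poly (pderiv (P i)) x)"
  have A: "?A \<in> carrier_mat n n" by (simp add: cyclic_shift_def mat_diag_def)
  show ?thesis
  proof (rule jordan_chain_not_diagonalizable[OF A])
    show v: "v \<in> carrier_vec n" and w: "w \<in> carrier_vec n" by (simp_all add: v_def w_def)
    have m: "Suc i mod n < n" for i using n by simp
    have dim: "dim_row (mat_diag n \<mu>) = n" by (simp add: mat_diag_def)
    show "?A *\<^sub>v v = x \<cdot>\<^sub>v v"
      using cyclic_pencil_mult_vec[OF n _ v, of _ t \<mu>] A n
      by (intro eq_vecI) (auto simp: v_def m dim modn Suc algebra_simps)
    show "?A *\<^sub>v w = x \<cdot>\<^sub>v w + v"
      using cyclic_pencil_mult_vec[OF n _ w, of _ t \<mu>] A n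
      by (intro eq_vecI) (auto simp: v_def w_def m dim modn Suc algebra_simps)
    have "v $ 0 = 1" using n by (simp add: v_def P0)
    then show "v \<noteq> 0\<^sub>v n" using n by auto
  qed
qed

text \<open>Substituting \<open>t * u\<close> for the variable scales every linear factor by
  \<open>t\<close>; the second identity is the chain rule.\<close>

lemma poly_scaled_roots:
  fixes \<mu> :: "nat \<Rightarrow> 'a::field"
  assumes "p = (\<Prod>k<n. [:- \<mu> k, 1:])" "t \<noteq> 0"
  shows "poly (\<Prod>k<n. [:- (t * \<mu> k), 1:]) (t * u) = t ^ n * poly p u"
    and "t * poly (pderiv (\<Prod>k<n. [:- (t * \<mu> k), 1:])) (t * u) = t ^ n * poly (pderiv p) u"
proof -
  let ?P = "\<Prod>k<n. [:- (t * \<mu> k), 1:]"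
  have factor: "[:- (t * \<mu> k), 1:] \<circ>\<^sub>p [:0, t:] = Polynomial.smult t [:- \<mu> k, 1:]" for k
    by (simp add: pcompose_pCons)
  have P: "?P \<circ>\<^sub>p [:0, t:] = Polynomial.smult (t ^ n) p"
    unfolding assms(1) pcompose_prod factor prod_smult by simp
  have "poly (?P \<circ>\<^sub>p [:0, t:]) u = t ^ n * poly p u" unfolding P by simp
  then show "poly ?P (t * u) = t ^ n * poly p u" by (simp add: poly_pcompose mult.commute)
  have "poly (pderiv (?P \<circ>\<^sub>p [:0, t:])) u = t ^ n * poly (pderiv p) u"
    unfolding P by (simp add: pderiv_smult)
  then show "t * poly (pderiv ?P) (t * u) = t ^ n * poly (pderiv p) u"
    by (simp add: pderiv_pcompose poly_pcompose pderiv_pCons mult.commute)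
qed

text \<open>For the polynomial \<open>x ^ n - n * x\<close> the critical points satisfy
  \<open>u ^ (n - 1) = 1\<close> and have critical value \<open>u * (1 - n)\<close>. After scaling,
  the cyclic pencil is non-diagonalizable at \<open>t\<close> once
  \<open>t ^ n * u * (1 - n) = 1\<close> for such a \<open>u\<close>. Eliminating \<open>u\<close>
  leaves a binomial equation for \<open>t\<close> with \<open>n * (n - 1)\<close> distinct
  solutions.\<close>

lemma exists_separable_pencil:
  assumes n: "n \<ge> 2"
  shows "\<exists>A M :: 'a::{alg_closed_field, field_char_0} mat.
    A \<in> carrier_mat n n \<and> M \<in> carrier_mat n n \<and> mat_disc M \<noteq> 0 \<and>
    (\<exists>\<tau>. inj_on \<tau> {..<n * (n - 1)} \<and>
      (\<forall>k<n * (n - 1). poly (mat_disc (pencil A M)) (\<tau> k) = 0))"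
proof -
  define p where "p = monom 1 n - [:0, of_nat n :: 'a:]"
  have pderiv_p: "pderiv p = monom (of_nat n) (n - 1) - [:of_nat n:]"
    by (simp add: p_def pderiv_diff pderiv_monom pderiv_pCons)
  have poly_p: "poly p x = x ^ n - of_nat n * x" for x
    by (simp add: p_def poly_monom)
  have poly_p': "poly (pderiv p) x = of_nat n * (x ^ (n - 1) - 1)" for x
    by (simp add: pderiv_p poly_monom algebra_simps)
  have "degree p = n \<and> lead_coeff p = 1"
  proof -
    have "degree [:0, of_nat n :: 'a:] < degree (monom (1::'a) n)" using n by (simp add: degree_monom_eq)
    then have "degree p = n"
      unfolding p_def diff_conv_add_uminus
      by (subst degree_add_eq_left) (simp_all only: degree_minus degree_monom_eq one_neq_zero not_False_eq_True)
    then show ?thesis using n by (simp add: p_def coeff_pCons split: nat.splits)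
  qed
  then have deg: "degree p = n" and lead: "lead_coeff p = 1" by auto
  have n1: "(1 - of_nat n :: 'a) \<noteq> 0"
    using n by (metis eq_iff_diff_eq_0 of_nat_1 of_nat_eq_iff numeral_le_one_iff semiring_norm(69))
  have power_n: "x ^ n = x * x ^ (n - 1)" for x :: 'a
    using n by (cases n) auto
  have "poly (pderiv p) x \<noteq> 0" if "poly p x = 0" for x
  proof
    assume "poly (pderiv p) x = 0"
    then have x1: "x ^ (n - 1) = 1" using n by (simp add: poly_p')
    then have "x * (1 - of_nat n) = 0" using that by (simp add: poly_p power_n algebra_simps)
    then have "x = 0" using n1 by simp
    with x1 n show False by (simp add: power_0_left split: if_splits)
  qed
  moreover have "p \<noteq> 0" using deg n by auto
  ultimately obtain \<mu> where \<mu>: "inj_on \<mu> {..<n}" "p = (\<Prod>k<n. [:- \<mu> k, 1:])"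
    using distinct_roots_enumeration[of p] deg lead by auto
  define N where "N = n * (n - 1)"
  have "N > 0" using n by (simp add: N_def)
  \<comment> \<open>Raising \<open>t ^ n * u * (1 - n) = 1\<close> to the power \<open>n - 1\<close>
    and using \<open>u ^ (n - 1) = 1\<close> gives \<open>c * t ^ N = 1\<close>, the equation
    \<open>q = 0\<close>.\<close>
  define c where "c = (1 - of_nat n :: 'a) ^ (n - 1)"
  have "c \<noteq> 0" using n1 by (simp add: c_def)
  define q where "q = monom c N - 1"
  have poly_q: "poly q x = c * x ^ N - 1" for x by (simp add: q_def poly_monom)
  have "degree q = N"
    unfolding q_def using degree_add_eq_left[of "- 1" "monom c N"] \<open>N > 0\<close> \<open>c \<noteq> 0\<close>
    by (simp add: degree_monom_eq)
  have "poly (pderiv q) x \<noteq> 0" if "poly q x = 0" for x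
  proof -
    have "x \<noteq> 0" using that \<open>N > 0\<close> by (auto simp: poly_q power_0_left)
    then show ?thesis
      using \<open>N > 0\<close> \<open>c \<noteq> 0\<close> by (simp add: q_def pderiv_diff pderiv_monom poly_monom)
  qed
  moreover have "q \<noteq> 0" using \<open>degree q = N\<close> \<open>N > 0\<close> by auto
  ultimately obtain \<tau> where \<tau>: "inj_on \<tau> {..<N}"
    "q = Polynomial.smult (lead_coeff q) (\<Prod>k<N. [:- \<tau> k, 1:])"
    using distinct_roots_enumeration[of q] \<open>degree q = N\<close> by auto
  let ?A = "cyclic_shift n :: 'a mat" and ?M = "mat_diag n \<mu>"
  have A: "?A \<in> carrier_mat n n" and M: "?M \<in> carrier_mat n n"
    by (simp_all add: cyclic_shift_def mat_diag_def)
  have "poly (mat_disc (pencil ?A ?M)) (\<tau> k) = 0" if "k < N" for k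
  proof -
    define t where "t = \<tau> k"
    have "poly q t = 0" by (subst \<tau>(2)) (use that in \<open>auto simp: poly_prod t_def\<close>)
    then have ct: "c * t ^ N = 1" by (simp add: poly_q)
    then have "t \<noteq> 0" using \<open>N > 0\<close> by (auto simp: power_0_left)
    \<comment> \<open>Conversely, a root \<open>t\<close> of \<open>q\<close> determines the
      critical point: this \<open>u\<close> makes the scaled critical value 1, and
      \<open>c * t ^ N = 1\<close> makes it satisfy \<open>u ^ (n - 1) = 1\<close>.\<close>
    define u where "u = 1 / (t ^ n * (1 - of_nat n))"
    have tu: "t ^ n * (u * (1 - of_nat n)) = 1" using \<open>t \<noteq> 0\<close> n1 by (simp add: u_def)
    have "(t ^ n * (1 - of_nat n)) ^ (n - 1) = 1"
      using ct by (simp add: power_mult_distrib c_def N_def power_mult mult.commute)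
    then have u1: "u ^ (n - 1) = 1" by (simp add: u_def power_divide)
    then have "poly p u = u * (1 - of_nat n)" "poly (pderiv p) u = 0"
      by (simp_all add: poly_p poly_p' power_n algebra_simps)
    then have "poly (\<Prod>k<n. [:- (t * \<mu> k), 1:]) (t * u) = 1"
      "poly (pderiv (\<Prod>k<n. [:- (t * \<mu> k), 1:])) (t * u) = 0"
      using poly_scaled_roots[OF \<mu>(2) \<open>t \<noteq> 0\<close>, of u] tu \<open>t \<noteq> 0\<close> by auto
    then have "\<not> diagonalizable_mat (?A + t \<cdot>\<^sub>m ?M)"
      by (rule cyclic_pencil_not_diagonalizable[OF n])
    then show ?thesis
      unfolding t_def[symmetric] poly_mat_disc_pencil[OF A M] using A M
      by (intro not_diagonalizable_imp_mat_disc_eq_0[of _ n]) auto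
  qed
  moreover have "mat_disc ?M \<noteq> 0"
  proof -
    have "upper_triangular ?M" by (auto simp: mat_diag_def)
    moreover have "inj_on (\<lambda>k. ?M $$ (k, k)) {..<n}" using \<mu>(1) by (simp add: mat_diag_def inj_on_def)
    ultimately show ?thesis using mat_disc_upper_triangular_eq_0_iff[OF M] by blast
  qed
  ultimately show ?thesis using A M \<tau>(1) unfolding N_def by blast
qed

section \<open>The generic discriminant\<close>

definition generic_mat :: "nat \<Rightarrow> 'a::comm_ring_1 mat_poly mat" where
  "generic_mat r = mat r r indet"

definition generic_disc :: "nat \<Rightarrow> 'a::comm_ring_1 mat_poly" where
  "generic_disc r = mat_disc (generic_mat r)"

lemma generic_mat_carrier [simp]: "generic_mat r \<in> carrier_mat r r"
  by (simp add: generic_mat_def)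

lemma poly_eval_generic_disc:
  assumes "comm_ring_hom h"
  shows "poly_eval h x (generic_disc r) = mat_disc (mat r r x)"
proof -
  interpret h: comm_ring_hom h by fact
  have "map_mat (poly_eval h x) (generic_mat r) = mat r r x"
    by (intro eq_matI) (auto simp: generic_mat_def)
  then show ?thesis
    using comm_ring_hom.mat_disc_hom[OF h.comm_ring_hom_poly_eval generic_mat_carrier[of r], of x]
    by (simp add: generic_disc_def)
qed

lemma eval_generic_disc:
  assumes "A \<in> carrier_mat r r"
  shows "eval_mat_poly (generic_disc r) A = mat_disc A"
proof -
  have "mat r r (($$) A) = A" using assms by (intro eq_matI) auto
  then show ?thesis by (simp add: eval_mat_poly_eq poly_eval_generic_disc[OF comm_ring_hom_ident])
qed

lemma generic_mat_pow:
  assumes "i < r" "j < r"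
  shows "(generic_mat r ^\<^sub>m k) $$ (i, j) \<in> (mat_polys r :: 'a::comm_ring_1 mat_poly set)"
    and "homogeneous k ((generic_mat r ^\<^sub>m k) $$ (i, j) :: 'a mat_poly)"
proof -
  let ?X = "generic_mat r :: 'a mat_poly mat"
  have "(?X ^\<^sub>m k) $$ (i, j) \<in> mat_polys r \<and>
      homogeneous k ((?X ^\<^sub>m k) $$ (i, j))" using assms
  proof (induction k arbitrary: i j)
    case 0
    then show ?case
      using mat_polys_single[of 0 r 1] mat_polys_0 homogeneous_1 homogeneous_0
      by (auto simp: carrier_matD[OF generic_mat_carrier[of r]])
  next
    case (Suc k)
    have Y: "?X ^\<^sub>m k \<in> carrier_mat r r" by simp
    have expand: "(?X ^\<^sub>m Suc k) $$ (i, j) = (\<Sum>l<r. (?X ^\<^sub>m k) $$ (i, l) * ?X $$ (l, j))"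
      using Y Suc.prems by (simp add: scalar_prod_def atLeast0LessThan carrier_matD[OF generic_mat_carrier[of r]])
    have X1: "?X $$ (l, j) \<in> mat_polys r" "homogeneous 1 (?X $$ (l, j))" if "l < r" for l
      using that Suc.prems by (auto simp: generic_mat_def intro!: mat_polys_single homogeneous_single)
    have "homogeneous (Suc k) ((?X ^\<^sub>m k) $$ (i, l) * ?X $$ (l, j))" if "l < r" for l
      using homogeneous_mult[OF _ X1(2)[OF that], of k "(?X ^\<^sub>m k) $$ (i, l)"] Suc.IH[of i l]
        Suc.prems that by simp
    then show ?case unfolding expand
      using Suc.IH X1 Suc.prems by (auto intro!: mat_polys_sum mat_polys_mult homogeneous_sum)
  qed
  then show "(?X ^\<^sub>m k) $$ (i, j) \<in> mat_polys r" and "homogeneous k ((?X ^\<^sub>m k) $$ (i, j))"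
    by auto
qed

lemma generic_disc_form:
  shows "generic_disc r \<in> (mat_polys r :: 'a::comm_ring_1 mat_poly set)"
    and "homogeneous (r * (r - 1)) (generic_disc r :: 'a mat_poly)"
proof -
  let ?T = "\<lambda>k. mat_trace (generic_mat r ^\<^sub>m k) :: 'a mat_poly"
  have T: "?T k \<in> mat_polys r" "homogeneous k (?T k)" for k
    by (auto simp: mat_trace_def generic_mat_pow carrier_matD[OF generic_mat_carrier[of r]]
        intro!: mat_polys_sum homogeneous_sum)
  have sgn: "(signof p :: 'a mat_poly) = Poly_Mapping.single 0 (signof p)" for p :: "nat \<Rightarrow> nat"
    by simp
  have sgn': "(signof p :: 'a mat_poly) \<in> mat_polys r" "homogeneous 0 (signof p :: 'a mat_poly)"
    for p :: "nat \<Rightarrow> nat"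
    by (subst sgn, rule mat_polys_single homogeneous_single, simp)+
  show "generic_disc r \<in> (mat_polys r :: 'a mat_poly set)"
    unfolding generic_disc_def mat_disc_leibniz[OF generic_mat_carrier]
    by (intro mat_polys_sum mat_polys_mult sgn' mat_polys_prod T)
  show "homogeneous (r * (r - 1)) (generic_disc r :: 'a mat_poly)"
    unfolding generic_disc_def mat_disc_leibniz[OF generic_mat_carrier]
  proof (intro homogeneous_sum)
    fix p assume "p \<in> {p. p permutes {0..<r}}"
    then show "homogeneous (r * (r - 1)) (signof p * (\<Prod>i = 0..<r. ?T (i + p i)))"
      using homogeneous_mult[OF sgn'(2) homogeneous_prod[of "{0..<r}" "\<lambda>i. i + p i" "\<lambda>i. ?T (i + p i)"]] T
        sum_permutation_degrees[of p r] by auto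
  qed
qed

section \<open>Divisibility by the generic discriminant\<close>

lemma poly_eval_cong:
  assumes "F \<in> mat_polys r" "\<And>i j. i < r \<Longrightarrow> j < r \<Longrightarrow> x (i, j) = y (i, j)"
  shows "poly_eval h x F = poly_eval h y F"
  unfolding poly_eval_def mono_eval_def
proof (intro sum.cong arg_cong2[of _ _ _ _ "(*)"] prod.cong refl)
  fix m v assume "m \<in> Poly_Mapping.keys F" "v \<in> Poly_Mapping.keys m"
  then have "v \<in> {..<r} \<times> {..<r}" using assms(1) by (auto simp: mat_polys_def)
  then show "x v ^ Poly_Mapping.lookup m v = y v ^ Poly_Mapping.lookup m v"
    using assms(2) by auto
qed

text \<open>Setting the variables outside the \<open>r \<times> r\<close> block to zero is a retraction onto \<open>mat_polys r\<close>.\<close>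

lemma mat_polys_dvd:
  fixes F G H :: "'a::comm_ring_1 mat_poly"
  assumes "F \<in> mat_polys r" "G \<in> mat_polys r" "G = F * H"
  shows "\<exists>H'\<in>mat_polys r. G = F * H'"
proof -
  define x where "x v = (if v \<in> {..<r} \<times> {..<r} then indet v else (0 :: 'a mat_poly))" for v
  interpret c: comm_ring_hom "const_poly :: 'a \<Rightarrow> 'a mat_poly" by (rule comm_ring_hom_const_poly)
  have retract: "poly_eval const_poly x K = K" if "K \<in> mat_polys r" for K
    using poly_eval_cong[OF that, of x indet const_poly] by (simp add: x_def poly_eval_indet del: One_nat_def)
  have "poly_eval const_poly x H \<in> mat_polys r"
    unfolding poly_eval_def mono_eval_def
    by (intro mat_polys_sum mat_polys_mult mat_polys_prod mat_polys_power)
       (auto simp: x_def mat_polys_0 intro!: mat_polys_single)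
  moreover have "G = F * poly_eval const_poly x H"
    using arg_cong[OF assms(3), of "poly_eval const_poly x"] retract assms(1,2)
    by (simp add: c.poly_eval_mult)
  ultimately show ?thesis by blast
qed

lemma poly_eval_line:
  fixes C :: "('v \<Rightarrow>\<^sub>0 nat) \<Rightarrow>\<^sub>0 'a::comm_ring_1"
  shows "poly (poly_eval (\<lambda>a. [:a:]) (\<lambda>v. [:x v, y v:]) C) s = poly_eval (\<lambda>a. a) (\<lambda>v. x v + s * y v) C"
  using poly_eval_comp[OF comm_ring_hom_poly_at[where t = s] comm_ring_hom_constant,
      where x = "\<lambda>v. [:x v, y v:]" and F = C]
  by (simp add: o_def)

text \<open>Restrict to the lines through a point off the hypersurface.\<close>

lemma zero_off_hypersurface:
  fixes C D :: "('v \<Rightarrow>\<^sub>0 nat) \<Rightarrow>\<^sub>0 'a::{idom,ring_char_0}"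
  assumes "\<And>x. poly_eval (\<lambda>a. a) x D \<noteq> 0 \<Longrightarrow> poly_eval (\<lambda>a. a) x C = 0"
    and x0: "poly_eval (\<lambda>a. a) x0 D \<noteq> 0"
  shows "C = 0"
proof (rule poly_eval_zero_imp_zero)
  fix x :: "'v \<Rightarrow> 'a"
  define L where "L E = poly_eval (\<lambda>a. [:a:]) (\<lambda>v. [:x0 v, x v - x0 v:]) E"
    for E :: "('v \<Rightarrow>\<^sub>0 nat) \<Rightarrow>\<^sub>0 'a"
  have L: "poly (L E) s = poly_eval (\<lambda>a. a) (\<lambda>v. x0 v + s * (x v - x0 v)) E" for E s
    unfolding L_def by (rule poly_eval_line)
  have "poly (L D * L C) s = 0" for s
    using assms(1)[of "\<lambda>v. x0 v + s * (x v - x0 v)"] by (auto simp: L)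
  then have "L D * L C = 0" using poly_all_0_iff_0 by blast
  moreover have "poly (L D) 0 \<noteq> 0" using x0 by (simp add: L)
  then have "L D \<noteq> 0" by auto
  ultimately have "L C = 0" by simp
  then show "poly_eval (\<lambda>a. a) x C = 0" using L[of C 1] by simp
qed

text \<open>If one of the roots were double, dividing out its linear factor once would leave a
  polynomial of degree one less that still vanishes at all \<open>degree p\<close> points.\<close>

lemma distinct_roots_simple:
  fixes p :: "'a::idom poly"
  assumes "p \<noteq> 0" "inj_on \<tau> {..<degree p}" "\<And>k. k < degree p \<Longrightarrow> poly p (\<tau> k) = 0" "k < degree p"
  shows "poly (pderiv p) (\<tau> k) \<noteq> 0"
proof
  assume double: "poly (pderiv p) (\<tau> k) = 0"
  define L where "L = [:- \<tau> k, 1:]"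
  have L: "poly L x = x - \<tau> k" "pderiv L = 1" "L \<noteq> 0" "degree L = 1" for x
    by (simp_all add: L_def pderiv_pCons)
  obtain q where q: "p = L * q"
    using assms(3)[OF assms(4)] poly_eq_0_iff_dvd[of p "\<tau> k"] by (auto simp: L_def elim: dvdE)
  have "q \<noteq> 0" using assms(1) q by auto
  then have deg: "degree p = Suc (degree q)" unfolding q using L by (subst degree_mult_eq) auto
  have "pderiv p = q + L * pderiv q" unfolding q by (simp add: pderiv_mult L)
  then have "poly q (\<tau> k) = 0" using double by (simp add: L)
  moreover have "poly q (\<tau> l) = 0" if "l < degree p" "l \<noteq> k" for l
  proof -
    have "\<tau> l \<noteq> \<tau> k" using assms(2,4) that by (auto simp: inj_on_def)
    then show ?thesis using assms(3)[OF that(1)] by (simp add: q L)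
  qed
  ultimately have "\<tau> ` {..<degree p} \<subseteq> {x. poly q x = 0}" by auto
  then have "card (\<tau> ` {..<degree p}) \<le> card {x. poly q x = 0}"
    by (rule card_mono[OF poly_roots_finite[OF \<open>q \<noteq> 0\<close>]])
  then have "degree p \<le> card {x. poly q x = 0}" by (simp only: card_image[OF assms(2)] card_lessThan)
  then show False using card_poly_roots_bound[OF \<open>q \<noteq> 0\<close>] by (simp add: deg)
qed

lemma poly_many_roots_zero:
  fixes p :: "'a::idom poly"
  assumes "inj_on \<tau> {..<n}" "\<And>k. k < n \<Longrightarrow> poly p (\<tau> k) = 0" "p = 0 \<or> degree p < n"
  shows "p = 0"
proof (rule ccontr)
  assume "p \<noteq> 0"
  have "\<tau> ` {..<n} \<subseteq> {x. poly p x = 0}" using assms(2) by auto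
  then have "card (\<tau> ` {..<n}) \<le> card {x. poly p x = 0}"
    by (rule card_mono[OF poly_roots_finite[OF \<open>p \<noteq> 0\<close>]])
  then show False
    using card_poly_roots_bound[OF \<open>p \<noteq> 0\<close>] assms(3) \<open>p \<noteq> 0\<close> by (simp add: card_image[OF assms(1)])
qed

text \<open>The coefficients will be multivariate polynomials. Pseudo-division scales the dividend
  by a power of the leading coefficient, here 1, and so is genuine division with remainder.\<close>

lemma monic_division:
  fixes f g :: "'a::comm_ring_1 poly"
  assumes "lead_coeff g = 1"
  obtains q r where "f = g * q + r" "r = 0 \<or> degree r < degree g"
proof -
  have "g \<noteq> 0" using assms by auto
  then show ?thesis
    using pseudo_divmod[of g f "fst (pseudo_divmod f g)" "snd (pseudo_divmod f g)"] assms that by auto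
qed

lemma comm_ring_hom_map_poly:
  assumes "comm_ring_hom h"
  shows "comm_ring_hom (map_poly h)"
proof -
  interpret h: comm_ring_hom h by fact
  interpret map_poly_comm_ring_hom h ..
  show ?thesis by (rule comm_ring_hom_axioms)
qed

theorem generic_disc_dvd:
  fixes G :: "'a::{alg_closed_field, field_char_0} mat_poly"
  assumes r: "r \<ge> 2" and G: "G \<in> mat_polys r"
    and vanish: "\<And>A. A \<in> carrier_mat r r \<Longrightarrow> \<not> diagonalizable_mat A \<Longrightarrow> eval_mat_poly G A = 0"
  shows "\<exists>H\<in>mat_polys r. G = generic_disc r * H"
proof -
  obtain A0 M :: "'a mat" and \<tau>0 where A0: "A0 \<in> carrier_mat r r" and M: "M \<in> carrier_mat r r"
    and M0: "mat_disc M \<noteq> 0" and \<tau>0: "inj_on \<tau>0 {..<r * (r - 1)}"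
    "\<And>k. k < r * (r - 1) \<Longrightarrow> poly (mat_disc (pencil A0 M)) (\<tau>0 k) = 0"
    using exists_separable_pencil[OF r] by blast
  define N where "N = r * (r - 1)"
  define \<kappa> where "\<kappa> = mat_disc M"
  let ?c = "const_poly :: 'a \<Rightarrow> 'a mat_poly"
  let ?ev = "\<lambda>x. poly_eval (\<lambda>a::'a. a) x :: 'a mat_poly \<Rightarrow> 'a"
  interpret c: comm_ring_hom ?c by (rule comm_ring_hom_const_poly)
  have h: "comm_ring_hom (\<lambda>a. [:?c a:])"
    using comm_ring_hom_comp[OF comm_ring_hom_constant comm_ring_hom_const_poly]
    by (simp add: o_def)
  \<comment> \<open>\<open>\<phi> K\<close> is \<open>K (X + t M)\<close> as a polynomial in
    \<open>t\<close>, with coefficients that are polynomials in the entries of the generic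
    \<open>X\<close>.\<close>
  define \<phi> where "\<phi> = poly_eval (\<lambda>a. [:?c a:]) (\<lambda>v. [:indet v, ?c (M $$ v):])"
  have ev: "comm_ring_hom (?ev x)" for x
    by (rule comm_ring_hom.comm_ring_hom_poly_eval[OF comm_ring_hom_ident])
  have ev_const: "?ev x (?c a) = a" and ev_indet: "?ev x (indet v) = x v" and ev_0: "?ev x 0 = 0" for x a v
    by (simp_all add: comm_ring_hom.poly_eval_single[OF comm_ring_hom_ident]
        comm_ring_hom.poly_eval_0[OF comm_ring_hom_ident])
  have eval_\<phi>: "poly (map_poly (?ev x) (\<phi> K)) t = ?ev (\<lambda>v. x v + t * M $$ v) K" for x t K
  proof -
    have "map_poly (?ev x) [:?c a:] = [:a:]" "map_poly (?ev x) [:indet v, ?c a:] = [:x v, a:]" for a v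
      by (auto intro!: poly_eqI simp: coeff_map_poly coeff_pCons ev_0 ev_const ev_indet split: nat.splits simp del: One_nat_def)
    then have "map_poly (?ev x) (\<phi> K) = poly_eval (\<lambda>a. [:a:]) (\<lambda>v. [:x v, M $$ v:]) K"
      using poly_eval_comp[OF comm_ring_hom_map_poly[OF ev[of x]] h,
          where x = "\<lambda>v. [:indet v, ?c (M $$ v):]" and F = K]
      by (simp add: \<phi>_def o_def del: One_nat_def)
    then show ?thesis by (simp add: poly_eval_line)
  qed
  let ?F = "generic_disc r :: 'a mat_poly"
  have \<phi>F: "\<phi> ?F = mat_disc (pencil (generic_mat r) (map_mat ?c M))"
  proof -
    have "mat r r (\<lambda>v. [:indet v, ?c (M $$ v):]) = pencil (generic_mat r) (map_mat ?c M)"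
      using M by (intro eq_matI) (auto simp: pencil_def generic_mat_def)
    then show ?thesis by (simp add: \<phi>_def poly_eval_generic_disc[OF h])
  qed
  have cM: "map_mat ?c M \<in> carrier_mat r r" using M by simp
  have deg_\<phi>F: "degree (\<phi> ?F) \<le> N" "coeff (\<phi> ?F) N = ?c \<kappa>"
    using mat_disc_pencil_coeff[OF generic_mat_carrier cM]
    by (simp_all add: \<phi>F N_def \<kappa>_def c.mat_disc_hom[OF M])
  \<comment> \<open>Because \<open>\<kappa>\<close> is a nonzero constant, its inverse is again a
    constant polynomial, and the rescaled divisor is monic.\<close>
  define g where "g = Polynomial.smult (?c (1 / \<kappa>)) (\<phi> ?F)"
  have "degree g \<le> N" unfolding g_def using deg_\<phi>F(1) degree_smult_le order.trans by blast
  moreover have gN: "coeff g N = 1"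
    using deg_\<phi>F(2) M0 by (simp add: g_def \<kappa>_def mult_single)
  ultimately have deg_g: "degree g = N" by (intro antisym le_degree) auto
  have "lead_coeff g = 1" using gN deg_g by simp
  then obtain q R where qR: "\<phi> G = g * q + R" "R = 0 \<or> degree R < degree g"
    by (rule monic_division)
  note qR = qR[unfolded deg_g]
  have \<phi>F_x: "map_poly (?ev x) (\<phi> ?F) = mat_disc (pencil (mat r r x) M)" for x
  proof -
    have "poly (map_poly (?ev x) (\<phi> ?F)) t = poly (mat_disc (pencil (mat r r x) M)) t" for t
    proof -
      have "mat r r (\<lambda>v. x v + t * M $$ v) = mat r r x + t \<cdot>\<^sub>m M" using M by (intro eq_matI) auto
      then show ?thesis
        using poly_mat_disc_pencil[of "mat r r x" r M t] M
        by (simp add: eval_\<phi> poly_eval_generic_disc[OF comm_ring_hom_ident])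
    qed
    then show ?thesis by (intro poly_ext) auto
  qed
  have g_x: "map_poly (?ev x) g = Polynomial.smult (1 / \<kappa>) (mat_disc (pencil (mat r r x) M))" for x
  proof -
    interpret ev: comm_ring_hom "?ev x" by (rule ev)
    show ?thesis
      unfolding g_def \<phi>F_x[symmetric] by (intro poly_eqI) (simp add: coeff_map_poly ev.hom_mult ev_const)
  qed
  \<comment> \<open>Being monic, \<open>g\<close> keeps its degree when its coefficients are
    evaluated at any \<open>x\<close>.\<close>
  have g_x_monic: "degree (map_poly (?ev x) g) = N" "coeff (map_poly (?ev x) g) N = 1" for x
  proof -
    interpret ev: comm_ring_hom "?ev x" by (rule ev)
    show 1: "coeff (map_poly (?ev x) g) N = 1" by (simp add: coeff_map_poly gN)
    have "degree (map_poly (?ev x) g) \<le> N" using degree_map_poly_le[of "?ev x" g] deg_g by simp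
    with 1 show "degree (map_poly (?ev x) g) = N" by (intro antisym le_degree) auto
  qed
  have root_iff: "poly (map_poly (?ev x) g) t = 0 \<longleftrightarrow> poly (mat_disc (pencil (mat r r x) M)) t = 0"
    for x t using M0 by (simp add: g_x \<kappa>_def)
  \<comment> \<open>\<open>D\<close> is a polynomial in the entries of \<open>X\<close>; where it is
    nonzero, the discriminant along the pencil has \<open>N\<close> distinct roots.\<close>
  define D where "D = mat_disc (companion N g)"
  have D_x: "?ev x D = mat_disc (companion N (map_poly (?ev x) g))" for x
    unfolding D_def
    by (simp add: comm_ring_hom.mat_disc_hom[OF ev companion_carrier, symmetric]
        comm_ring_hom.companion_hom[OF ev])
  \<comment> \<open>The explicit pencil with \<open>N\<close> distinct roots shows that the open set
    where \<open>D\<close> is nonzero is nonempty.\<close>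
  have D0: "?ev (($$) A0) D \<noteq> 0"
  proof -
    have "mat r r (($$) A0) = A0" using A0 by (intro eq_matI) auto
    then show ?thesis unfolding D_x
      using \<tau>0 by (intro mat_disc_companion_neq_0[OF g_x_monic, of \<tau>0]) (auto simp: root_iff N_def)
  qed
  \<comment> \<open>It suffices to treat points where \<open>D\<close> is nonzero. There the
    evaluated remainder vanishes at \<open>N\<close> distinct values of \<open>t\<close> while its
    degree is below \<open>N\<close>.\<close>
  have "coeff R i = 0" for i
  proof (rule zero_off_hypersurface[OF _ D0])
    fix x assume "?ev x D \<noteq> 0"
    then obtain \<tau> where \<tau>: "inj_on \<tau> {..<N}" "\<And>k. k < N \<Longrightarrow> poly (map_poly (?ev x) g) (\<tau> k) = 0"
      unfolding D_x using companion_distinct_roots[OF g_x_monic] by blast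
    interpret m: comm_ring_hom "map_poly (?ev x)" by (rule comm_ring_hom_map_poly[OF ev])
    let ?g = "map_poly (?ev x) g" and ?A = "mat r r x"
    have A: "?A \<in> carrier_mat r r" by simp
    have g0: "?g \<noteq> 0" using g_x_monic(2)[of x] by (metis coeff_0 zero_neq_one)
    have "poly (map_poly (?ev x) R) (\<tau> k) = 0" if "k < N" for k
    proof -
      have "poly (pderiv ?g) (\<tau> k) \<noteq> 0"
        using distinct_roots_simple[OF g0, of \<tau> k] \<tau> that by (simp add: g_x_monic)
      then have simple: "poly (pderiv (mat_disc (pencil ?A M))) (\<tau> k) \<noteq> 0"
        by (auto simp: g_x pderiv_smult)
      have root: "poly (mat_disc (pencil ?A M)) (\<tau> k) = 0"
        using \<tau>(2)[OF that] by (simp add: root_iff)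
      have nd: "\<not> diagonalizable_mat (?A + \<tau> k \<cdot>\<^sub>m M)"
        by (rule simple_root_not_diagonalizable[OF A M root simple])
      have "poly (map_poly (?ev x) (\<phi> G)) (\<tau> k) = ?ev (\<lambda>v. x v + \<tau> k * M $$ v) G"
        by (rule eval_\<phi>)
      \<comment> \<open>The assignment \<open>x\<close> also has values at index pairs outside the
        \<open>r \<times> r\<close> block, but \<open>G\<close> involves only variables inside
        it.\<close>
      also have "\<dots> = ?ev (($$) (?A + \<tau> k \<cdot>\<^sub>m M)) G"
        using M by (intro poly_eval_cong[OF G]) auto
      also have "\<dots> = 0" using vanish[OF _ nd] M by (simp add: eval_mat_poly_eq)
      finally have "poly (map_poly (?ev x) (g * q + R)) (\<tau> k) = 0" unfolding qR(1) .
      then show ?thesis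
        using \<tau>(2)[OF that] by (simp add: m.hom_add m.hom_mult)
    qed
    moreover have "map_poly (?ev x) R = 0 \<or> degree (map_poly (?ev x) R) < N"
      using qR(2) degree_map_poly_le[of "?ev x" R] by auto
    ultimately have "map_poly (?ev x) R = 0" using \<tau>(1) by (intro poly_many_roots_zero[of \<tau> N]) auto
    then have "coeff (map_poly (?ev x) R) i = 0" by simp
    then show "?ev x (coeff R i) = 0" by (simp add: coeff_map_poly ev_0)
  qed
  then have "R = 0" by (intro poly_eqI) simp
  \<comment> \<open>At t = 0 the line \<open>X + t M\<close> passes through the generic point, so
    \<open>K\<close> itself is recovered.\<close>
  have at_0: "poly (\<phi> K) 0 = K" for K
    unfolding \<phi>_def using poly_eval_comp[OF comm_ring_hom_poly_at[where t = 0] h,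
        where x = "\<lambda>v. [:indet v, ?c (M $$ v):]" and F = K]
    by (simp add: o_def poly_eval_indet del: One_nat_def)
  have "poly (\<phi> G) 0 = poly (g * q) 0" using qR(1) \<open>R = 0\<close> by simp
  then have "G = ?F * (?c (1 / \<kappa>) * poly q 0)"
    by (simp add: at_0 g_def mult_ac)
  \<comment> \<open>The cofactor found so far is an arbitrary polynomial; the retraction replaces it
    by one in the variables of the \<open>r \<times> r\<close> block.\<close>
  then show ?thesis by (rule mat_polys_dvd[OF generic_disc_form(1) G])
qed

section \<open>Chern classes of the tangent bundle\<close>

lemma regular_on_mono: "S \<subseteq> T \<Longrightarrow> regular_on n S \<subseteq> regular_on n T"
  by (auto simp: regular_on_def)

lemma regular_on_0: "0 \<in> regular_on n S"
  by (simp add: regular_on_def)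

lemma regular_on_single:
  assumes "Poly_Mapping.keys m \<subseteq> {..n}" "(\<Sum>l\<le>n. Poly_Mapping.lookup m l) = 0"
    "\<And>l. l \<notin> S \<Longrightarrow> Poly_Mapping.lookup m l \<ge> 0"
  shows "Poly_Mapping.single m c \<in> regular_on n S"
  using assms by (simp add: regular_on_def)

lemma regular_on_1: "1 \<in> regular_on n S"
  using regular_on_single[of 0 n S 1] by simp

lemma regular_on_add: "f \<in> regular_on n S \<Longrightarrow> g \<in> regular_on n S \<Longrightarrow> f + g \<in> regular_on n S"
  unfolding regular_on_def using Poly_Mapping.keys_add[of f g] by blast

lemma regular_on_uminus: "f \<in> regular_on n S \<Longrightarrow> - f \<in> regular_on n S"
  by (simp add: regular_on_def)

lemma regular_on_mult:
  assumes "f \<in> regular_on n S" "g \<in> regular_on n S"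
  shows "f * g \<in> regular_on n S"
  unfolding regular_on_def
proof (intro CollectI ballI)
  fix m assume "m \<in> Poly_Mapping.keys (f * g)"
  then obtain a b where m: "m = a + b" "a \<in> Poly_Mapping.keys f" "b \<in> Poly_Mapping.keys g"
    using keys_mult by blast
  have "Poly_Mapping.keys (a + b) \<subseteq> Poly_Mapping.keys a \<union> Poly_Mapping.keys b"
    by (rule Poly_Mapping.keys_add)
  moreover from assms m have
    "Poly_Mapping.keys a \<subseteq> {..n}" "Poly_Mapping.keys b \<subseteq> {..n}"
    "(\<Sum>l\<le>n. Poly_Mapping.lookup a l) = 0" "(\<Sum>l\<le>n. Poly_Mapping.lookup b l) = 0"
    "\<And>l. l \<notin> S \<Longrightarrow> Poly_Mapping.lookup a l \<ge> 0" "\<And>l. l \<notin> S \<Longrightarrow> Poly_Mapping.lookup b l \<ge> 0"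
    by (auto simp: regular_on_def)
  ultimately show "Poly_Mapping.keys m \<subseteq> {..n} \<and> (\<Sum>l\<le>n. Poly_Mapping.lookup m l) = 0 \<and>
      (\<forall>l. l \<notin> S \<longrightarrow> 0 \<le> Poly_Mapping.lookup m l)"
    using m(1) by (auto simp: lookup_add sum.distrib)
qed

lemma regular_on_sum: "(\<And>s. s \<in> A \<Longrightarrow> f s \<in> regular_on n S) \<Longrightarrow> sum f A \<in> regular_on n S"
  by (induction A rule: infinite_finite_induct) (auto simp: regular_on_0 regular_on_add)

definition coord_ratio :: "nat \<Rightarrow> nat \<Rightarrow> 'a::comm_ring_1 laurent" where
  "coord_ratio k i = hcoord_pow k 1 * hcoord_pow i (- 1)"

lemma coord_ratio_single:
  "coord_ratio k i = Poly_Mapping.single (Poly_Mapping.single k 1 + Poly_Mapping.single i (- 1)) 1"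
  by (simp add: coord_ratio_def hcoord_pow_def mult_single)

lemma coord_ratio_same [simp]: "coord_ratio i i = 1"
proof -
  have "Poly_Mapping.single i (1::int) + Poly_Mapping.single i (- 1) = 0"
    by (simp flip: single_add)
  then show ?thesis by (simp add: coord_ratio_single)
qed

lemma coord_ratio_mult: "coord_ratio k j * coord_ratio j i = coord_ratio k i"
  by (simp add: coord_ratio_single mult_single single_uminus)

lemma coord_ratio_mult': "coord_ratio j i * coord_ratio k j = coord_ratio k i"
  using coord_ratio_mult[of k j i] by (simp add: mult.commute)

lemma coord_ratio_regular:
  assumes "i \<le> n" "k \<le> n" "i \<in> S"
  shows "coord_ratio k i \<in> regular_on n S"
  unfolding coord_ratio_single
proof (rule regular_on_single)
  show "Poly_Mapping.keys (Poly_Mapping.single k (1::int) + Poly_Mapping.single i (- 1)) \<subseteq> {..n}"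
    using assms Poly_Mapping.keys_add[of "Poly_Mapping.single k (1::int)" "Poly_Mapping.single i (- 1)"]
    by (auto split: if_splits)
  show "(\<Sum>l\<le>n. Poly_Mapping.lookup (Poly_Mapping.single k 1 + Poly_Mapping.single i (- 1)) l) = (0::int)"
    using assms by (simp add: lookup_add lookup_single sum.distrib when_def)
qed (use assms in \<open>auto simp: lookup_add lookup_single when_def\<close>)

lemma twisting_bundle_1: "twisting_bundle 1 i j = mat 1 1 (\<lambda>_. coord_ratio j i)"
  by (simp add: twisting_bundle_def coord_ratio_def)

lemma twisting_bundle_0: "twisting_bundle 0 i j = 1\<^sub>m 1"
  by (rule eq_matI) (simp_all add: twisting_bundle_def hcoord_pow_def mult_single)

lemma regular_matsI:
  assumes "M \<in> carrier_mat m m" "\<And>a b. a < m \<Longrightarrow> b < m \<Longrightarrow> M $$ (a, b) \<in> regular_on n S"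
  shows "M \<in> regular_mats n m S"
  using assms by (auto simp: regular_mats_def elements_mat_def)

lemma regular_matsD:
  assumes "M \<in> regular_mats n m S"
  shows "M \<in> carrier_mat m m" "\<And>a b. a < m \<Longrightarrow> b < m \<Longrightarrow> M $$ (a, b) \<in> regular_on n S"
proof -
  show M: "M \<in> carrier_mat m m" using assms by (simp add: regular_mats_def)
  show "M $$ (a, b) \<in> regular_on n S" if "a < m" "b < m" for a b
    using elements_matI[OF M that refl] assms by (auto simp: regular_mats_def)
qed

lemma regular_mats_mono: "S \<subseteq> T \<Longrightarrow> regular_mats n m S \<subseteq> regular_mats n m T"
  using regular_on_mono[of S T n] by (auto simp: regular_mats_def)

lemma regular_mats_mult:
  assumes "M \<in> regular_mats n m S" "N \<in> regular_mats n m S"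
  shows "M * N \<in> regular_mats n m S"
proof (rule regular_matsI)
  note M = regular_matsD[OF assms(1)] and N = regular_matsD[OF assms(2)]
  show "M * N \<in> carrier_mat m m" using M N by auto
  fix a b assume "a < m" "b < m"
  then show "(M * N) $$ (a, b) \<in> regular_on n S"
    using M N by (auto simp: scalar_prod_def intro!: regular_on_sum regular_on_mult)
qed

lemma regular_mats_1: "1\<^sub>m m \<in> regular_mats n m S"
  by (rule regular_matsI) (auto simp: regular_on_0 regular_on_1)

section \<open>Direct sums of O(1)\<close>

definition twist_sum :: "nat \<Rightarrow> 'a::comm_ring_1 cocycle" where
  "twist_sum m i j = coord_ratio j i \<cdot>\<^sub>m 1\<^sub>m m"

lemma twist_sum_carrier [simp]: "twist_sum m i j \<in> carrier_mat m m"
  by (simp add: twist_sum_def)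

lemma twist_sum_dim [simp]: "dim_row (twist_sum m i j) = m" "dim_col (twist_sum m i j) = m"
  by (simp_all add: twist_sum_def)

lemma vector_bundle_twist_sum: "vector_bundle n m (twist_sum m)"
  unfolding vector_bundle_def
proof (intro conjI allI impI)
  fix i j assume "i \<le> n" "j \<le> n"
  then show "twist_sum m i j \<in> regular_mats n m {i, j}"
    by (intro regular_matsI)
       (auto simp: twist_sum_def regular_on_0 coord_ratio_regular)
next
  fix i show "twist_sum m i i = 1\<^sub>m m" by (intro eq_matI) (auto simp: twist_sum_def)
next
  fix i j k
  show "twist_sum m i j * twist_sum m j k = twist_sum m i k"
    unfolding twist_sum_def
    by (subst mult_smult_assoc_mat[where nr=m and n=m and nc=m], simp, simp,
        subst mult_smult_distrib[where nr=m and n=m and nc=m])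
       (auto intro!: eq_matI simp: coord_ratio_mult')
qed

lemma twist_sum_1: "twist_sum 1 = twisting_bundle 1"
  by (intro ext eq_matI) (auto simp: twist_sum_def twisting_bundle_1)

lemma vector_bundle_twisting_1: "vector_bundle n 1 (twisting_bundle 1)"
  using vector_bundle_twist_sum[of n 1] unfolding twist_sum_1 .

text \<open>Splitting off one summand is an extension with zero off-diagonal block, which makes the
  Whitney formula available for an induction on the rank.\<close>

lemma bundle_extension_twist_sum:
  "bundle_extension n 1 m (twisting_bundle 1) (twist_sum (Suc m)) (twist_sum m)"
  unfolding bundle_extension_def
proof (intro conjI allI impI)
  fix i j
  show "\<exists>B\<in>carrier_mat 1 m. twist_sum (Suc m) i j =
      four_block_mat (twisting_bundle 1 i j) B (0\<^sub>m m 1) (twist_sum m i j)"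
    by (rule bexI[of _ "0\<^sub>m 1 m"], rule eq_matI)
       (auto simp: twist_sum_def twisting_bundle_1 four_block_mat_def Let_def)
qed (use vector_bundle_twisting_1 in \<open>simp_all add: vector_bundle_twist_sum\<close>)

lemma chern_classes_extension:
  assumes "chern_classes n c" "bundle_extension n p q E F G" "k \<le> n"
  shows "c F k = (\<Sum>i\<le>k. c E i * c G (k - i))"
proof -
  from assms(1) have "\<forall>p q E F G. bundle_extension n p q E F G \<longrightarrow>
        (\<forall>k\<le>n. c F k = (\<Sum>i\<le>k. c E i * c G (k - i)))"
    unfolding chern_classes_def by (elim conjE)
  from this[rule_format, OF assms(2,3)] show ?thesis .
qed

lemma chern_classes_iso:
  assumes "chern_classes n c" "vector_bundle n m E" "vector_bundle n m F" "bundle_iso n m E F" "k \<le> n"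
  shows "c E k = c F k"
proof -
  from assms(1) have "\<forall>m E F. vector_bundle n m E \<and> vector_bundle n m F \<and> bundle_iso n m E F \<longrightarrow>
        (\<forall>k\<le>n. c E k = c F k)"
    unfolding chern_classes_def by (elim conjE)
  with assms(2-) show ?thesis by blast
qed

text \<open>The total Chern class is \<open>(1 + h) ^ m\<close>: multiplying by \<open>1 + h\<close>
  for each new summand O(1) is Pascal's rule. The induction starts at O(1) itself.\<close>

lemma chern_classes_twist_sum:
  fixes c :: "'a::field cocycle \<Rightarrow> nat \<Rightarrow> int"
  assumes c: "chern_classes n c" and "m > 0" "k \<le> n"
  shows "c (twist_sum m) k = int (m choose k)"
  using \<open>m > 0\<close> \<open>k \<le> n\<close>
proof (induction m arbitrary: k rule: nat_induct_non_zero)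
  case 1
  then show ?case
    using c unfolding twist_sum_1 chern_classes_def by (cases k) (auto simp: binomial_eq_0)
next
  case (Suc m)
  have line: "c (twisting_bundle 1) i = (if i \<le> 1 then 1 else 0)" if "i \<le> n" for i
    using c that unfolding chern_classes_def by auto
  have "c (twist_sum (Suc m)) k =
      (\<Sum>i\<le>k. c (twisting_bundle 1) i * c (twist_sum m) (k - i))"
    using Suc.prems by (intro chern_classes_extension[OF c bundle_extension_twist_sum])
  \<comment> \<open>Only \<open>c\<^sub>0\<close> and \<open>c\<^sub>1\<close> of O(1) are nonzero;
    the intersection with \<open>{..k}\<close> accounts for \<open>k = 0\<close>.\<close>
  also have "\<dots> = (\<Sum>i\<in>{..k} \<inter> {..1}. c (twist_sum m) (k - i))"
    using Suc.prems by (intro sum.mono_neutral_cong_right) (auto simp: line)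
  also have "\<dots> = (\<Sum>i\<in>{..k} \<inter> {..1}. int (m choose (k - i)))"
    using Suc by (intro sum.cong) auto
  also have "\<dots> = int (Suc m choose k)"
  proof (cases k)
    case 0
    then show ?thesis by simp
  next
    case (Suc l)
    then have "{..k} \<inter> {..1} = {0, 1::nat}" by auto
    with Suc show ?thesis by simp
  qed
  finally show ?case .
qed

section \<open>Frames adapted to the Euler sequence\<close>

text \<open>The frame of \<open>O(1)\<^sup>n\<^sup>+\<^sup>1\<close> over \<open>U\<^sub>i\<close> adapted to the Euler sequence
  \<open>0 \<rightarrow> O \<rightarrow> O(1)\<^sup>n\<^sup>+\<^sup>1 \<rightarrow> T \<rightarrow> 0\<close>: a section \<open>v\<close> is sent to \<open>v\<^sub>i\<close> and the components
  \<open>v\<^sub>k - (x\<^sub>k / x\<^sub>i) v\<^sub>i\<close> of its image in the tangent bundle.\<close>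

definition euler_frame :: "nat \<Rightarrow> nat \<Rightarrow> 'a::comm_ring_1 laurent mat" where
  "euler_frame n i = mat (Suc n) (Suc n) (\<lambda>(a, l).
     if a = 0 then if l = i then 1 else 0
     else if l = i then - coord_ratio (chart_index i (a - 1)) i
     else if l = chart_index i (a - 1) then 1 else 0)"

text \<open>The inverse of \<open>euler_frame n i\<close>. Its first column is the Euler vector
  field normalized on the chart, spanning the subbundle O; the others are the standard basis vectors
  other than the one of index \<open>i\<close>.\<close>

definition euler_coframe :: "nat \<Rightarrow> nat \<Rightarrow> 'a::comm_ring_1 laurent mat" where
  "euler_coframe n i = mat (Suc n) (Suc n) (\<lambda>(l, b).
     if b = 0 then coord_ratio l i else if l = chart_index i (b - 1) then 1 else 0)"

lemma chart_index_neq [simp]: "chart_index i a \<noteq> i" "i \<noteq> chart_index i a"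
  by (auto simp: chart_index_def)

lemma chart_index_eq_iff [simp]: "chart_index i a = chart_index i b \<longleftrightarrow> a = b"
  by (auto simp: chart_index_def)

lemma chart_index_le: "a < n \<Longrightarrow> chart_index i a \<le> n"
  by (auto simp: chart_index_def)

lemma chart_index_cases:
  assumes "l \<noteq> i" "l \<le> n" "i \<le> n"
  obtains a where "a < n" "l = chart_index i a"
proof (cases "l < i")
  case True
  with assms show ?thesis by (intro that[of l]) (auto simp: chart_index_def)
next
  case False
  with assms show ?thesis by (intro that[of "l - 1"]) (auto simp: chart_index_def)
qed

lemma euler_frame_row:
  assumes "i \<le> n" "a \<le> n"
  shows "(\<Sum>l=0..<Suc n. euler_frame n i $$ (a, l) * v l) =
    (if a = 0 then v i
     else v (chart_index i (a - 1)) - coord_ratio (chart_index i (a - 1)) i * v i)"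
proof -
  let ?S = "{0..<Suc n}"
  have "a - 1 < n" if "a \<noteq> 0" using that assms by auto
  then have ci: "chart_index i (a - 1) \<in> ?S" if "a \<noteq> 0"
    using that chart_index_le[of "a - 1" n i] by auto
  have i: "i \<in> ?S" using assms by auto
  show ?thesis
  proof (cases "a = 0")
    case True
    then have "(\<Sum>l\<in>?S. euler_frame n i $$ (a, l) * v l) = (\<Sum>l\<in>?S. if l = i then v i else 0)"
      by (intro sum.cong) (auto simp: euler_frame_def)
    with True i show ?thesis by simp
  next
    case False
    have "(\<Sum>l\<in>?S. euler_frame n i $$ (a, l) * v l) =
        (\<Sum>l\<in>?S. (if l = chart_index i (a - 1) then v (chart_index i (a - 1)) else 0) +
          (if l = i then - coord_ratio (chart_index i (a - 1)) i * v i else 0))"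
      using False assms(2) by (intro sum.cong) (auto simp: euler_frame_def)
    also have "\<dots> = v (chart_index i (a - 1)) - coord_ratio (chart_index i (a - 1)) i * v i"
      using i ci[OF False] by (simp only: sum.distrib) simp
    finally show ?thesis using False by simp
  qed
qed

lemma euler_frame_carrier [simp]: "euler_frame n i \<in> carrier_mat (Suc n) (Suc n)"
  and euler_coframe_carrier [simp]: "euler_coframe n i \<in> carrier_mat (Suc n) (Suc n)"
  by (simp_all add: euler_frame_def euler_coframe_def)

lemma euler_frame_dim [simp]:
  "dim_row (euler_frame n i) = Suc n" "dim_col (euler_frame n i) = Suc n"
  "dim_row (euler_coframe n i) = Suc n" "dim_col (euler_coframe n i) = Suc n"
  by (simp_all add: euler_frame_def euler_coframe_def)

lemma euler_frame_mult:
  assumes "i \<le> n" "M \<in> carrier_mat (Suc n) m" "a \<le> n" "b < m"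
  shows "(euler_frame n i * M) $$ (a, b) =
    (if a = 0 then M $$ (i, b)
     else M $$ (chart_index i (a - 1), b) - coord_ratio (chart_index i (a - 1)) i * M $$ (i, b))"
proof -
  have "(euler_frame n i * M) $$ (a, b) =
      (\<Sum>l=0..<Suc n. euler_frame n i $$ (a, l) * M $$ (l, b))"
    using assms by (simp add: scalar_prod_def less_Suc_eq_le del: sum.op_ivl_Suc)
  also have "\<dots> = (if a = 0 then M $$ (i, b)
     else M $$ (chart_index i (a - 1), b) - coord_ratio (chart_index i (a - 1)) i * M $$ (i, b))"
    using assms by (intro euler_frame_row[of i n a "\<lambda>l. M $$ (l, b)"]) auto
  finally show ?thesis .
qed

lemma euler_frame_coframe:
  assumes "i \<le> n"
  shows "euler_frame n i * euler_coframe n i = 1\<^sub>m (Suc n)"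
proof (rule eq_matI)
  fix a b assume *: "a < dim_row (1\<^sub>m (Suc n) :: 'a laurent mat)" "b < dim_col (1\<^sub>m (Suc n) :: 'a laurent mat)"
  then show "(euler_frame n i * euler_coframe n i) $$ (a, b) = (1\<^sub>m (Suc n) :: 'a laurent mat) $$ (a, b)"
    using assms chart_index_le[of "a - 1" n i]
    by (subst euler_frame_mult[where m = "Suc n"]) (auto simp: euler_coframe_def less_Suc_eq_le)
qed (simp_all add: euler_frame_def euler_coframe_def)

lemma euler_coframe_frame:
  assumes "i \<le> n"
  shows "euler_coframe n i * euler_frame n i = (1\<^sub>m (Suc n) :: 'a::comm_ring_1 laurent mat)"
proof (rule eq_matI)
  let ?C = "euler_coframe n i :: 'a laurent mat" and ?F = "euler_frame n i :: 'a laurent mat"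
  fix l k assume *: "l < dim_row (1\<^sub>m (Suc n) :: 'a laurent mat)" "k < dim_col (1\<^sub>m (Suc n) :: 'a laurent mat)"
  have "(?C * ?F) $$ (l, k) = (\<Sum>a=0..<Suc n. ?C $$ (l, a) * ?F $$ (a, k))"
    using * by (simp add: scalar_prod_def del: sum.op_ivl_Suc)
  also have "\<dots> = coord_ratio l i * (if k = i then 1 else 0) +
      (\<Sum>a=0..<n. (if l = chart_index i a then 1 else 0) *
        (if k = i then - coord_ratio (chart_index i a) i else if k = chart_index i a then 1 else 0))"
    using * by (subst sum.atLeast0_lessThan_Suc_shift)
      (simp add: euler_frame_def euler_coframe_def cong: if_cong)
  also have "\<dots> = (if l = k then 1 else 0)"
  proof (cases "l = i")
    case True
    then show ?thesis by auto
  next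
    case False
    then obtain a where a: "a < n" "l = chart_index i a"
      using * assms chart_index_cases[of l i n] by auto
    have "(\<Sum>a=0..<n. (if l = chart_index i a then 1 else 0) *
        (if k = i then - coord_ratio (chart_index i a) i else if k = chart_index i a then 1 else 0)) =
      (\<Sum>a'=0..<n. if a' = a then (if k = i then - coord_ratio l i else if k = l then 1 else 0 :: 'a laurent) else 0)"
      using a by (intro sum.cong) auto
    with a False show ?thesis by auto
  qed
  finally show "(?C * ?F) $$ (l, k) = (1\<^sub>m (Suc n) :: 'a laurent mat) $$ (l, k)" using * by auto
qed (simp_all add: euler_frame_def euler_coframe_def)

section \<open>The tangent bundle as a quotient in the Euler sequence\<close>

lemma laurent_deriv_single:
  "laurent_deriv l (Poly_Mapping.single m 1) =
   Poly_Mapping.single (m - Poly_Mapping.single l 1) (of_int (Poly_Mapping.lookup m l))"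
  \<comment> \<open>In the zero ring the monomial has no keys, so this case is treated
    separately.\<close>
  by (cases "(1::'a) = 0") (simp_all add: laurent_deriv_def)

lemma tangent_bundle_carrier [simp]: "tangent_bundle n i j \<in> carrier_mat n n"
  by (simp add: tangent_bundle_def)

lemma tangent_bundle_dim [simp]:
  "dim_row (tangent_bundle n i j) = n" "dim_col (tangent_bundle n i j) = n"
  by (simp_all add: tangent_bundle_def)

text \<open>The derivative of \<open>x\<^sub>k / x\<^sub>i\<close> with respect to
  \<open>x\<^sub>l\<close> is nonzero only for \<open>l = k\<close> or \<open>l = i\<close>, and
  these cases exclude each other since \<open>k \<noteq> i\<close>. The factor
  \<open>x\<^sub>j\<close> makes the result homogeneous of degree zero.\<close>

lemma tangent_bundle_index:
  assumes "a < n" "b < n"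
  shows "tangent_bundle n i j $$ (a, b) =
    coord_ratio j i * ((if chart_index i a = chart_index j b then 1 else 0) -
      (if chart_index j b = i then coord_ratio (chart_index i a) i else 0))"
proof -
  define k l where "k = chart_index i a" and "l = chart_index j b"
  have ki: "k \<noteq> i" by (simp add: k_def)
  let ?s = "\<lambda>v e. Poly_Mapping.single v (e::int)"
  have "tangent_bundle n i j $$ (a, b) = hcoord_pow j 1 * laurent_deriv l (coord_ratio k i)"
    using assms by (simp add: tangent_bundle_def affine_coord_def coord_ratio_def k_def l_def)
  also have "\<dots> = Poly_Mapping.single (?s j 1 + (?s k 1 + ?s i (- 1) - ?s l 1))
      (of_int (Poly_Mapping.lookup (?s k 1 + ?s i (- 1)) l))"
    by (simp add: coord_ratio_single laurent_deriv_single hcoord_pow_def mult_single)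
  also have "\<dots> = coord_ratio j i * ((if k = l then 1 else 0) -
      (if l = i then coord_ratio k i else 0))"
  proof (cases "k = l \<or> l = i")
    case True
    with ki show ?thesis
      by (auto simp: coord_ratio_single mult_single lookup_add lookup_single when_def
          single_uminus lookup_minus algebra_simps)
  next
    case False
    then show ?thesis by (simp add: lookup_add lookup_single when_def)
  qed
  finally show ?thesis unfolding k_def l_def .
qed

text \<open>The transition matrices of the direct sum of \<open>n + 1\<close> copies of O(1),
  rewritten in the adapted frames. The scalar transition matrix is absorbed into the coframe, which
  leaves a single product to compute entrywise.\<close>

definition euler_cocycle :: "nat \<Rightarrow> 'a::comm_ring_1 cocycle" where
  "euler_cocycle n i j = euler_frame n i * (coord_ratio j i \<cdot>\<^sub>m euler_coframe n j)"

lemma euler_cocycle_eq: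
  "(euler_cocycle n i j :: 'a::comm_ring_1 laurent mat) =
    euler_frame n i * twist_sum (Suc n) i j * euler_coframe n j"
    (is "_ = ?F * ?T * ?C")
proof -
  have "?F * ?T * ?C = ?F * (?T * ?C)"
    by (rule assoc_mult_mat) auto
  also have "?T * ?C = coord_ratio j i \<cdot>\<^sub>m ?C"
    unfolding twist_sum_def by (subst mult_smult_assoc_mat[where nr="Suc n" and n="Suc n" and nc="Suc n"]) auto
  finally show ?thesis by (simp add: euler_cocycle_def)
qed

text \<open>The scaled Euler vector on chart \<open>j\<close> is the Euler vector on chart
  \<open>i\<close>, because \<open>x\<^sub>j / x\<^sub>i\<close> times
  \<open>x\<^sub>l / x\<^sub>j\<close> is \<open>x\<^sub>l / x\<^sub>i\<close>. So the first column
  is a unit vector and the subbundle is O. The remaining block is the Jacobian matrix of the chart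
  change.\<close>

lemma euler_cocycle_block:
  assumes "i \<le> n" "j \<le> n"
  shows "\<exists>B\<in>carrier_mat 1 n. (euler_cocycle n i j :: 'a::comm_ring_1 laurent mat) =
    four_block_mat (twisting_bundle 0 i j) B (0\<^sub>m n 1) (tangent_bundle n i j)"
proof -
  let ?E = "euler_cocycle n i j :: 'a laurent mat"
  let ?B = "mat 1 n (\<lambda>(a, b). ?E $$ (0, Suc b))"
  have index: "?E $$ (a, b) = (if a = 0 then coord_ratio j i * euler_coframe n j $$ (i, b)
     else coord_ratio j i * (euler_coframe n j $$ (chart_index i (a - 1), b) -
       coord_ratio (chart_index i (a - 1)) i * euler_coframe n j $$ (i, b)))"
    if "a \<le> n" "b \<le> n" for a b
    unfolding euler_cocycle_def using that assms chart_index_le[of "a - 1" n i]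
    by (subst euler_frame_mult[where m = "Suc n"])
       (auto simp: right_diff_distrib mult.left_commute less_Suc_eq_le)
  have "?E = four_block_mat (twisting_bundle 0 i j) ?B (0\<^sub>m n 1) (tangent_bundle n i j)"
  proof (rule eq_matI)
    fix a b
    assume "a < dim_row (four_block_mat (twisting_bundle 0 i j :: 'a laurent mat) ?B (0\<^sub>m n 1) (tangent_bundle n i j))"
      "b < dim_col (four_block_mat (twisting_bundle 0 i j :: 'a laurent mat) ?B (0\<^sub>m n 1) (tangent_bundle n i j))"
    then have ab: "a \<le> n" "b \<le> n" by (auto simp: twisting_bundle_0)
    consider "a = 0" "b = 0" | "a = 0" "b > 0" | "a > 0" "b = 0" | "a > 0" "b > 0" by auto
    then show "?E $$ (a, b) =
        four_block_mat (twisting_bundle 0 i j) ?B (0\<^sub>m n 1) (tangent_bundle n i j) $$ (a, b)"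
    proof cases
      case 1
      then show ?thesis using assms
        by (simp add: index twisting_bundle_0 euler_coframe_def coord_ratio_mult')
    next
      case 2
      then show ?thesis using ab by (simp add: twisting_bundle_0)
    next
      case 3
      then have "chart_index i (a - 1) \<le> n" using ab by (intro chart_index_le) auto
      with 3 ab assms show ?thesis
        by (simp add: index twisting_bundle_0 euler_coframe_def coord_ratio_mult less_Suc_eq_le)
    next
      case 4
      then have "chart_index i (a - 1) \<le> n" using ab by (intro chart_index_le) auto
      with 4 ab assms show ?thesis
        by (simp add: index twisting_bundle_0 euler_coframe_def less_Suc_eq_le
            tangent_bundle_index)
    qed
  qed (auto simp: euler_cocycle_def twisting_bundle_0 tangent_bundle_def)
  then show ?thesis by (intro bexI[of _ ?B]) auto
qed

lemma euler_frame_regular: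
  assumes "i \<le> n"
  shows "euler_frame n i \<in> regular_mats n (Suc n) {i}"
    and "euler_coframe n i \<in> regular_mats n (Suc n) {i}"
proof -
  show "euler_frame n i \<in> regular_mats n (Suc n) {i}"
  proof (rule regular_matsI)
    fix a b assume ab: "a < Suc n" "b < Suc n"
    show "euler_frame n i $$ (a, b) \<in> regular_on n {i}"
    proof (cases "a = 0")
      case False
      then have "chart_index i (a - 1) \<le> n" using ab by (intro chart_index_le) auto
      with ab assms show ?thesis
        by (auto simp: euler_frame_def intro!: regular_on_uminus coord_ratio_regular
            regular_on_0 regular_on_1)
    qed (use ab in \<open>auto simp: euler_frame_def regular_on_0 regular_on_1\<close>)
  qed simp
  show "euler_coframe n i \<in> regular_mats n (Suc n) {i}"
    using assms by (intro regular_matsI)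
      (auto simp: euler_coframe_def regular_on_0 regular_on_1 intro!: coord_ratio_regular)
qed

text \<open>In a product of two transition matrices the adjacent coframe and frame over the middle
  chart cancel, so the cocycle rule carries over from \<open>twist_sum\<close>.\<close>

lemma vector_bundle_euler_cocycle:
  "vector_bundle n (Suc n) (euler_cocycle n :: 'a::comm_ring_1 cocycle)"
proof -
  let ?F = "euler_frame n :: _ \<Rightarrow> 'a laurent mat" and ?C = "euler_coframe n :: _ \<Rightarrow> 'a laurent mat"
  let ?T = "twist_sum (Suc n) :: 'a cocycle"
  let ?E = "euler_cocycle n :: 'a cocycle"
  have tw: "vector_bundle n (Suc n) ?T" by (rule vector_bundle_twist_sum)
  note tw = this[unfolded vector_bundle_def]
  let ?N = "Suc n"
  have "?E i j \<in> regular_mats n ?N {i, j}" if "i \<le> n" "j \<le> n" for i j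
  proof -
    have "?F i \<in> regular_mats n ?N {i, j}" "?C j \<in> regular_mats n ?N {i, j}"
      using euler_frame_regular that regular_mats_mono[of "{i}" "{i, j}"]
        regular_mats_mono[of "{j}" "{i, j}"] by blast+
    moreover have "?T i j \<in> regular_mats n ?N {i, j}" using tw that by blast
    ultimately show ?thesis unfolding euler_cocycle_eq by (intro regular_mats_mult)
  qed
  moreover have "?E i i = 1\<^sub>m ?N" if "i \<le> n" for i
  proof -
    have "?T i i = 1\<^sub>m ?N" using tw that by blast
    then show ?thesis
      unfolding euler_cocycle_eq using that by (simp add: euler_frame_coframe)
  qed
  moreover have "?E i j * ?E j k = ?E i k"
    if "i \<le> n" "j \<le> n" "k \<le> n" for i j k
  proof -
    have "?E i j * ?E j k =
        ?F i * ?T i j * (?C j * ?F j) * ?T j k * ?C k"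
      unfolding euler_cocycle_eq
      by (simp add: assoc_mult_mat[of _ ?N ?N _ ?N _ ?N] mult_carrier_mat[of _ ?N ?N _ ?N])
    also have "\<dots> = ?F i * (?T i j * ?T j k) * ?C k"
      using that by (simp add: euler_coframe_frame assoc_mult_mat[of _ ?N ?N _ ?N _ ?N] mult_carrier_mat[of _ ?N ?N _ ?N])
    also have "?T i j * ?T j k = ?T i k" using tw that by blast
    finally show ?thesis by (simp add: euler_cocycle_eq)
  qed
  ultimately show ?thesis unfolding vector_bundle_def by blast
qed

lemma bundle_iso_euler: "bundle_iso n (Suc n) (twist_sum (Suc n)) (euler_cocycle n)"
  unfolding bundle_iso_def
proof (rule exI[of _ "euler_frame n"], rule exI[of _ "euler_coframe n"], intro conjI allI impI)
  fix i j assume "i \<le> n" "j \<le> n"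
  let ?N = "Suc n"
  show "euler_cocycle n i j * euler_frame n j = euler_frame n i * twist_sum ?N i j"
    unfolding euler_cocycle_eq using \<open>j \<le> n\<close>
    by (simp add: assoc_mult_mat[of _ ?N ?N _ ?N _ ?N] mult_carrier_mat[of _ ?N ?N _ ?N] euler_coframe_frame)
qed (simp_all add: euler_frame_regular euler_frame_coframe euler_coframe_frame)

text \<open>The bundle axioms are inherited as those of the lower right block of
  \<open>euler_cocycle\<close>; this takes the place of a chain rule for
  \<open>laurent_deriv\<close>.\<close>

lemma vector_bundle_tangent_bundle:
  "vector_bundle n n (tangent_bundle n :: 'a::comm_ring_1 cocycle)"
proof -
  have "vector_bundle n (Suc n) (euler_cocycle n :: 'a cocycle)"
    by (rule vector_bundle_euler_cocycle)
  note E = this[unfolded vector_bundle_def]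
  let ?E = "euler_cocycle n :: 'a cocycle"
  have block: "tangent_bundle n i j $$ (a, b) = ?E i j $$ (Suc a, Suc b)"
    if "i \<le> n" "j \<le> n" "a < n" "b < n" for a b i j
  proof -
    obtain B where B: "B \<in> carrier_mat 1 n" "?E i j =
      four_block_mat (twisting_bundle 0 i j) B (0\<^sub>m n 1) (tangent_bundle n i j)"
      using euler_cocycle_block \<open>i \<le> n\<close> \<open>j \<le> n\<close> by blast
    show ?thesis unfolding B(2) using that by (simp add: twisting_bundle_0)
  qed
  have "(tangent_bundle n i j :: 'a laurent mat) \<in> regular_mats n n {i, j}" if "i \<le> n" "j \<le> n" for i j
    using E that by (intro regular_matsI) (auto simp: block intro!: regular_matsD(2)[where m = "Suc n"])
  moreover have "tangent_bundle n i i = (1\<^sub>m n :: 'a laurent mat)" if "i \<le> n" for i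
  proof (rule eq_matI)
    fix a b assume "a < dim_row (1\<^sub>m n :: 'a laurent mat)" "b < dim_col (1\<^sub>m n :: 'a laurent mat)"
    moreover have "?E i i = (1\<^sub>m (Suc n) :: 'a laurent mat)" using E that by blast
    ultimately show "tangent_bundle n i i $$ (a, b) = (1\<^sub>m n :: 'a laurent mat) $$ (a, b)"
      using that by (simp add: block)
  qed (simp_all add: tangent_bundle_def)
  moreover have "tangent_bundle n i j * tangent_bundle n j k = (tangent_bundle n i k :: 'a laurent mat)"
    if ijk: "i \<le> n" "j \<le> n" "k \<le> n" for i j k
  proof (rule eq_matI)
    let ?T = "\<lambda>i j. tangent_bundle n i j :: 'a laurent mat"
    fix a b assume "a < dim_row (?T i k)" "b < dim_col (?T i k)"
    then have ab: "a < n" "b < n" by (auto simp: tangent_bundle_def)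
    obtain B where B: "?E i j =
      four_block_mat (twisting_bundle 0 i j) B (0\<^sub>m n 1) (?T i j)"
      using euler_cocycle_block ijk by blast
    \<comment> \<open>The vanishing lower left block removes the term \<open>l = 0\<close> from the
      matrix product, so lower right blocks multiply among themselves.\<close>
    have zero: "?E i j $$ (Suc a, 0) = 0"
      unfolding B using ab by (auto simp: twisting_bundle_0)
    have dims: "dim_row (?E i j) = Suc n" "dim_col (?E i j) = Suc n" for i j
      by (auto simp: euler_cocycle_def)
    have "(?T i j * ?T j k) $$ (a, b) = (\<Sum>l=0..<n. ?T i j $$ (a, l) * ?T j k $$ (l, b))"
      using ab by (simp add: scalar_prod_def tangent_bundle_def)
    also have "\<dots> = (\<Sum>l=0..<n. ?E i j $$ (Suc a, Suc l) * ?E j k $$ (Suc l, Suc b))"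
      using ab ijk by (intro sum.cong) (auto simp: block)
    also have "\<dots> = (\<Sum>l=0..<Suc n. ?E i j $$ (Suc a, l) * ?E j k $$ (l, Suc b))"
      by (subst sum.atLeast0_lessThan_Suc_shift) (simp add: zero)
    also have "\<dots> = (?E i j * ?E j k) $$ (Suc a, Suc b)"
      using ab by (simp add: scalar_prod_def dims del: sum.op_ivl_Suc)
    also have "?E i j * ?E j k = ?E i k"
      using E ijk by blast
    finally show "(?T i j * ?T j k) $$ (a, b) = ?T i k $$ (a, b)"
      using ab ijk by (simp add: block)
  qed (simp_all add: tangent_bundle_def)
  ultimately show ?thesis unfolding vector_bundle_def by blast
qed

lemma vector_bundle_twisting_0: "vector_bundle n 1 (twisting_bundle 0)"
  by (simp add: vector_bundle_def twisting_bundle_0 regular_mats_1)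

lemma bundle_extension_euler:
  "bundle_extension n 1 n (twisting_bundle 0) (euler_cocycle n) (tangent_bundle n)"
  unfolding bundle_extension_def
proof (intro conjI allI impI)
  show "vector_bundle n 1 (twisting_bundle 0)" by (rule vector_bundle_twisting_0)
qed (use vector_bundle_euler_cocycle[of n] in
    \<open>simp_all add: vector_bundle_tangent_bundle euler_cocycle_block del: One_nat_def\<close>,
    simp)

text \<open>The total Chern class of O is 1, so the Whitney formula for the Euler sequence gives the
  tangent bundle that of the middle term, \<open>(1 + h) ^ (n + 1)\<close>.\<close>

theorem chern_classes_tangent_bundle:
  fixes c :: "'a::field cocycle \<Rightarrow> nat \<Rightarrow> int"
  assumes c: "chern_classes n c" and "k \<le> n"
  shows "c (tangent_bundle n) k = int (Suc n choose k)"
proof -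
  have line: "c (twisting_bundle 0) i = (if i = 0 then 1 else 0)" if "i \<le> n" for i
    using c that unfolding chern_classes_def by auto
  have "int (Suc n choose k) = c (twist_sum (Suc n)) k"
    by (rule chern_classes_twist_sum[symmetric]) (use assms in auto)
  also have "\<dots> = c (euler_cocycle n) k"
    by (rule chern_classes_iso[OF c vector_bundle_twist_sum vector_bundle_euler_cocycle
          bundle_iso_euler \<open>k \<le> n\<close>])
  also have "\<dots> = (\<Sum>i\<le>k. c (twisting_bundle 0) i * c (tangent_bundle n) (k - i))"
    by (rule chern_classes_extension[OF c bundle_extension_euler \<open>k \<le> n\<close>])
  also have "\<dots> = (\<Sum>i\<le>k. if i = 0 then c (tangent_bundle n) k else 0)"
    using \<open>k \<le> n\<close> by (intro sum.cong) (auto simp: line)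
  finally show ?thesis by simp
qed

section \<open>The closure of the non-diagonalizable matrices\<close>

lemma eval_mat_poly_smult:
  assumes "F \<in> mat_polys r" "homogeneous d F" "A \<in> carrier_mat r r"
  shows "eval_mat_poly F (c \<cdot>\<^sub>m A) = c ^ d * eval_mat_poly F A"
proof -
  have "(\<Prod>v\<in>Poly_Mapping.keys m. ((c \<cdot>\<^sub>m A) $$ v) ^ Poly_Mapping.lookup m v) =
      c ^ d * (\<Prod>v\<in>Poly_Mapping.keys m. (A $$ v) ^ Poly_Mapping.lookup m v)"
    if m: "m \<in> Poly_Mapping.keys F" for m
  proof -
    have "(c \<cdot>\<^sub>m A) $$ v = c * A $$ v" if "v \<in> Poly_Mapping.keys m" for v
    proof -
      have "v \<in> {..<r} \<times> {..<r}" using assms(1) m that by (auto simp: mat_polys_def)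
      then show ?thesis using assms(3) by auto
    qed
    then have "(\<Prod>v\<in>Poly_Mapping.keys m. ((c \<cdot>\<^sub>m A) $$ v) ^ Poly_Mapping.lookup m v) =
        (\<Prod>v\<in>Poly_Mapping.keys m. c ^ Poly_Mapping.lookup m v * (A $$ v) ^ Poly_Mapping.lookup m v)"
      by (intro prod.cong) (auto simp: power_mult_distrib)
    also have "\<dots> = c ^ (\<Sum>v\<in>Poly_Mapping.keys m. Poly_Mapping.lookup m v) *
        (\<Prod>v\<in>Poly_Mapping.keys m. (A $$ v) ^ Poly_Mapping.lookup m v)"
      by (simp add: prod.distrib power_sum)
    also have "(\<Sum>v\<in>Poly_Mapping.keys m. Poly_Mapping.lookup m v) = d"
      using assms(2) m by (simp add: homogeneous_def)
    finally show ?thesis .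
  qed
  then show ?thesis by (simp add: eval_mat_poly_def sum_distrib_left mult.left_commute)
qed

text \<open>Membership in \<open>zero_locus\<close> only provides some representative on which
  \<open>S\<close> vanishes; homogeneity carries the vanishing over to the given one.\<close>

lemma proj_point_in_zero_locus:
  assumes "S \<subseteq> forms r" "A \<in> nonzero_mats r"
  shows "proj_point A \<in> zero_locus r S \<longleftrightarrow> (\<forall>F\<in>S. eval_mat_poly F A = 0)"
proof
  assume "proj_point A \<in> zero_locus r S"
  then obtain B where B: "proj_point A = proj_point B" "B \<in> nonzero_mats r"
    "\<forall>F\<in>S. eval_mat_poly F B = 0" by (auto simp: zero_locus_def)
  have "A = 1 \<cdot>\<^sub>m A" by (intro eq_matI) auto
  then have "A \<in> proj_point A" by (force simp: proj_point_def)
  then obtain c where c: "A = c \<cdot>\<^sub>m B" unfolding B(1) by (auto simp: proj_point_def)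
  show "\<forall>F\<in>S. eval_mat_poly F A = 0"
  proof
    fix F assume "F \<in> S"
    then obtain d where "F \<in> mat_polys r" "homogeneous d F" using assms(1) by (auto simp: forms_def)
    then show "eval_mat_poly F A = 0"
      unfolding c using B(2,3) \<open>F \<in> S\<close> by (subst eval_mat_poly_smult) (auto simp: nonzero_mats_def)
  qed
qed (use assms in \<open>auto simp: zero_locus_def\<close>)

lemma generic_disc_in_forms: "generic_disc r \<in> forms r"
  using generic_disc_form by (auto simp: forms_def)

text \<open>The zero matrix is diagonal, so passing to projective space loses no non-diagonalizable
  matrix.\<close>

lemma not_diagonalizable_nonzero:
  assumes "A \<in> carrier_mat r r" "\<not> diagonalizable_mat A"
  shows "A \<in> nonzero_mats r"
proof -
  have "diagonalizable_mat (0\<^sub>m r r :: 'a mat)"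
    unfolding diagonalizable_mat_def diagonal_mat_def
    by (rule exI[of _ "0\<^sub>m r r"]) (auto intro: similar_mat_refl[of _ r])
  with assms show ?thesis by (auto simp: nonzero_mats_def)
qed

lemma generic_disc_dvd_form:
  fixes G :: "'a::{alg_closed_field, field_char_0} mat_poly"
  assumes "r \<ge> 2" "G \<in> mat_polys r"
    and "\<And>A. A \<in> nonzero_mats r \<Longrightarrow> \<not> diagonalizable_mat A \<Longrightarrow> eval_mat_poly G A = 0"
  shows "\<exists>H\<in>mat_polys r. G = generic_disc r * H"
  using assms by (intro generic_disc_dvd) (auto intro: not_diagonalizable_nonzero)

lemma eval_mat_poly_mult: "eval_mat_poly (F * G) A = eval_mat_poly F A * eval_mat_poly G A"
  by (simp add: eval_mat_poly_eq comm_ring_hom.poly_eval_mult[OF comm_ring_hom_ident])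

lemma eval_generic_disc_not_diagonalizable:
  fixes A :: "'a::alg_closed_field mat"
  assumes "A \<in> nonzero_mats r" "\<not> diagonalizable_mat A"
  shows "eval_mat_poly (generic_disc r) A = 0"
  using assms not_diagonalizable_imp_mat_disc_eq_0[of A r]
  by (auto simp: nonzero_mats_def eval_generic_disc)

text \<open>The discriminant locus is closed and contains the non-diagonalizable points. Conversely,
  every form in the equations of a closed set containing these points is a multiple of the
  discriminant.\<close>

lemma nondiag_closure_eq:
  assumes "r \<ge> 2"
  shows "nondiag_closure r =
    (zero_locus r {generic_disc r} :: 'a::{alg_closed_field, field_char_0} mat set set)"
proof
  let ?F = "generic_disc r :: 'a mat_poly"
  let ?X = "{proj_point A | A. A \<in> nonzero_mats r \<and> \<not> diagonalizable_mat A} :: 'a mat set set"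
  have F: "{?F} \<subseteq> forms r" using generic_disc_in_forms by auto
  have "?X \<subseteq> zero_locus r {?F}"
    using proj_point_in_zero_locus[OF F] eval_generic_disc_not_diagonalizable by auto
  then show "nondiag_closure r \<subseteq> zero_locus r {?F}"
    using F unfolding nondiag_closure_def zariski_closure_def zariski_closed_def
    by (intro Inter_lower CollectI conjI exI[of _ "{?F}"]) auto
  show "zero_locus r {?F} \<subseteq> nondiag_closure r"
    unfolding nondiag_closure_def zariski_closure_def
  proof (intro Inter_greatest)
    fix Z assume "Z \<in> {Z. zariski_closed r Z \<and> ?X \<subseteq> Z}"
    then obtain S where S: "S \<subseteq> forms r" "Z = zero_locus r S" "?X \<subseteq> zero_locus r S"
      by (auto simp: zariski_closed_def)
    show "zero_locus r {?F} \<subseteq> Z"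
    proof
      fix p assume "p \<in> zero_locus r {?F}"
      then obtain A where A: "p = proj_point A" "A \<in> nonzero_mats r" "eval_mat_poly ?F A = 0"
        by (auto simp: zero_locus_def)
      have "eval_mat_poly G A = 0" if "G \<in> S" for G
      proof -
        have "eval_mat_poly G B = 0" if "B \<in> nonzero_mats r" "\<not> diagonalizable_mat B" for B
          using proj_point_in_zero_locus[OF S(1) that(1)] S(3) that \<open>G \<in> S\<close> by blast
        moreover have "G \<in> mat_polys r" using S(1) that by (auto simp: forms_def)
        ultimately obtain H where "G = ?F * H" using generic_disc_dvd_form[OF assms] by blast
        then show ?thesis using A(3) by (simp add: eval_mat_poly_mult)
      qed
      then show "p \<in> Z" using A(1,2) S(2) proj_point_in_zero_locus[OF S(1) A(2)] by simp
    qed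
  qed
qed

lemma hypersurface_nondiag_closure:
  assumes r: "r \<ge> 2"
  shows "hypersurface_of_degree r
    (nondiag_closure r :: 'a::{alg_closed_field, field_char_0} mat set set) (r * (r - 1))"
  unfolding hypersurface_of_degree_def
proof (intro conjI bexI)
  let ?F = "generic_disc r :: 'a mat_poly" and ?Z = "nondiag_closure r :: 'a mat set set"
  have F: "{?F} \<subseteq> forms r" using generic_disc_in_forms by auto
  note Z = nondiag_closure_eq[OF r, where 'a = 'a]
  show "0 < r * (r - 1)" using r by simp
  show "?F \<noteq> 0"
  proof
    assume "?F = 0"
    moreover obtain M :: "'a mat" where "M \<in> carrier_mat r r" "mat_disc M \<noteq> 0"
      using exists_separable_pencil[OF r] by blast
    ultimately show False
      using eval_generic_disc[of M r] by (simp add: eval_mat_poly_def)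
  qed
  show "homogeneous (r * (r - 1)) ?F" "?F \<in> mat_polys r" by (rule generic_disc_form)+
  show "?Z = zero_locus r {?F}" by (rule Z)
  show "vanishing_ideal r ?Z = {?F * G | G. G \<in> mat_polys r}"
  proof (intro equalityI subsetI)
    fix G assume "G \<in> vanishing_ideal r ?Z"
    then have G: "G \<in> mat_polys r"
      "\<And>A. A \<in> nonzero_mats r \<Longrightarrow> proj_point A \<in> ?Z \<Longrightarrow> eval_mat_poly G A = 0"
      by (auto simp: vanishing_ideal_def)
    have "eval_mat_poly G A = 0" if "A \<in> nonzero_mats r" "\<not> diagonalizable_mat A" for A
    proof (rule G(2)[OF that(1)])
      show "proj_point A \<in> ?Z"
        unfolding Z proj_point_in_zero_locus[OF F that(1)]
        using eval_generic_disc_not_diagonalizable[OF that] by simp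
    qed
    then show "G \<in> {?F * G | G. G \<in> mat_polys r}"
      using generic_disc_dvd_form[OF r G(1)] by blast
  next
    fix G assume "G \<in> {?F * G | G. G \<in> mat_polys r}"
    then obtain H where H: "G = ?F * H" "H \<in> mat_polys r" by blast
    have "eval_mat_poly G A = 0" if "A \<in> nonzero_mats r" "proj_point A \<in> ?Z" for A
      using that proj_point_in_zero_locus[OF F that(1)] unfolding Z
      by (simp add: H(1) eval_mat_poly_mult)
    then show "G \<in> vanishing_ideal r ?Z"
      using mat_polys_mult[OF generic_disc_form(1) H(2)] by (simp add: vanishing_ideal_def H(1))
  qed
qed

theorem theorem6p1:
  fixes r :: nat
  assumes "r \<ge> 2"
  shows "\<exists>d. hypersurface_of_degree r
               (nondiag_closure r :: 'a::{alg_closed_field, field_char_0} mat set set) d \<and>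
             (\<forall>c :: 'a cocycle \<Rightarrow> nat \<Rightarrow> int. chern_classes (r - 1) c \<longrightarrow>
                int d = 2 * c (tangent_bundle (r - 1)) (r - 2))"
proof (intro exI conjI allI impI)
  show "hypersurface_of_degree r (nondiag_closure r :: 'a mat set set) (r * (r - 1))"
    by (rule hypersurface_nondiag_closure[OF assms])
  fix c :: "'a cocycle \<Rightarrow> nat \<Rightarrow> int"
  assume "chern_classes (r - 1) c"
  then have "c (tangent_bundle (r - 1)) (r - 2) = int (Suc (r - 1) choose (r - 2))"
    by (rule chern_classes_tangent_bundle) simp
  also have "Suc (r - 1) choose (r - 2) = r choose 2"
    using assms binomial_symmetric[of 2 r] by simp
  finally have c: "c (tangent_bundle (r - 1)) (r - 2) = int (r choose 2)" .
  show "int (r * (r - 1)) = 2 * c (tangent_bundle (r - 1)) (r - 2)"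
  proof -
    \<comment> \<open>\<open>choose_two\<close> is stated with \<open>div\<close>, so evenness is
      what makes the doubling exact.\<close>
    have "even (r * (r - 1))" using assms by (cases r) auto
    then have "r * (r - 1) = 2 * (r choose 2)" by (simp add: choose_two)
    then show ?thesis unfolding c by simp
  qed
qed

end
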